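(* Let $\Bbbk$ be a field of characteristic $0$, let $n\ge3$, and let $\Omega\in\Bbbk^{[n+1]}=\Bbbk[t_1,\dots,t_{n+1}]$ be an i.s. potential of degree $n+1+d_0$ where $d_0\ge2$. Then the Nambu-Poisson algebra $P_\Omega$ has a unique connected grading such that it is Poisson $d_0$-graded.
   Context: A Nambu-Poisson algebra ($n$-Lie Poisson algebra) is a commutative $\Bbbk$-algebra $P$ with an $n$-ary $\Bbbk$-multilinear bracket $\{-,\dots,-\}$ that vanishes whenever two arguments are equal, satisfies $\{\{u_1,\dots,u_n\},v_1,\dots,v_{n-1}\}=\sum_{s=1}^n\{u_1,\dots,u_{s-1},\{u_s,v_1,\dots,v_{n-1}\},u_{s+1},\dots,u_n\}$, and satisfies the Leibniz rule in each argument. An i.s. potential is a homogeneous element $\Omega\in\Bbbk^{[n+1]}$ (with $\deg t_i=1$ for all $i$) such that $\Bbbk^{[n+1]}/(\Omega_{t_1},\dots,\Omega_{t_{n+1}})$ is finite-dimensional over $\Bbbk$, where $\Omega_{t_i}=\partial\Omega/\partial t_i$. $A_\Omega$ denotes $\Bbbk^{[n+1]}$ with the Nambu-Poisson bracket $\{f_1,\dots,f_n\}=\det\frac{\partial(f_1,\dots,f_n,\Omega)}{\partial(t_1,\dots,t_{n+1})}$ (the Jacobian determinant whose last row is the gradient of $\Omega$), and $P_\Omega=A_\Omega/(\Omega)$ with the induced bracket. A $\mathbb Z$-graded algebra $A=\bigoplus_{i\in\mathbb Z}A_i$ is connected graded if $A_i=0$ for all $i>0$ and $A_0=\Bbbk$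 (so it lives in nonpositive degrees). For $w\in\mathbb Z$, a Nambu-Poisson algebra $A$ is (Poisson) $w$-graded if it is a $\mathbb Z$-graded commutative algebra $A=\bigoplus_iA_i$ with $\{A_{i_1},\dots,A_{i_n}\}\subseteq A_{(\sum_s i_s)-w}$ for all $i_1,\dots,i_n\in\mathbb Z$. *)

theory Defs
  imports "HOL-Library.Poly_Mapping" "HOL-Algebra.QuotRing" "Jordan_Normal_Form.VS_Connect"
begin

section \<open>Polynomial algebras\<close>

text \<open>
  Multivariate polynomials are finitely supported maps from exponents to coefficients, with the
  convolution product. The variable written \<open>t\<^sub>i\<^sub>+\<^sub>1\<close> in the literature has index \<open>i\<close>, so
  that \<open>\<k>[t\<^sub>1, \<dots>, t\<^sub>N]\<close> consists of the polynomials in the variables with index \<open>< N\<close>.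
  The field of scalars \<open>\<k>\<close> is the type \<open>'a\<close>; as a record it is \<open>class_ring\<close>.
\<close>

type_synonym 'a mpoly = "(nat \<Rightarrow>\<^sub>0 nat) \<Rightarrow>\<^sub>0 'a"

definition poly_alg :: "nat \<Rightarrow> ('a::comm_ring_1, 'a mpoly) module" where
  "poly_alg N =
    \<lparr>carrier = {p. \<forall>m \<in> Poly_Mapping.keys p. Poly_Mapping.keys m \<subseteq> {..<N}},
     mult = (*), one = 1, zero = 0, add = (+),
     smult = (\<lambda>c p. Poly_Mapping.single 0 c * p)\<rparr>"

text \<open>
  The subtraction of exponents is truncated; it is only truncated in terms whose coefficient
  \<open>of_nat (lookup m i)\<close> vanishes.
\<close>

definition partial :: "nat \<Rightarrow> 'a::comm_ring_1 mpoly \<Rightarrow> 'a mpoly" where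
  "partial i p = (\<Sum>m \<in> Poly_Mapping.keys p.
     Poly_Mapping.single (m - Poly_Mapping.single i 1)
       (of_nat (Poly_Mapping.lookup m i) * Poly_Mapping.lookup p m))"

definition homogeneous :: "nat \<Rightarrow> 'a::comm_ring_1 mpoly \<Rightarrow> bool" where
  "homogeneous d p \<longleftrightarrow>
     (\<forall>m \<in> Poly_Mapping.keys p. (\<Sum>i \<in> Poly_Mapping.keys m. Poly_Mapping.lookup m i) = d)"

section \<open>Nambu-Poisson algebras\<close>

text \<open>
  The bracket of a list \<open>[u\<^sub>1, \<dots>, u\<^sub>n]\<close> is constrained only for lists of length \<open>n\<close>.
\<close>

record ('a, 'b) nambu_alg = "('a, 'b) module" +
  nbracket :: "'b list \<Rightarrow> 'b"

locale nambu_poisson_algebra = algebra K P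
  for n :: nat and K :: "('a, 'c) ring_scheme" and P :: "('a, 'b, 'd) nambu_alg_scheme" +
  assumes bracket_closed:
    "\<lbrakk>length us = n; set us \<subseteq> carrier P\<rbrakk> \<Longrightarrow> nbracket P us \<in> carrier P"
  and bracket_add:
    "\<lbrakk>length us = n; set us \<subseteq> carrier P; s < n; x \<in> carrier P; y \<in> carrier P\<rbrakk> \<Longrightarrow>
      nbracket P (us[s := x \<oplus>\<^bsub>P\<^esub> y]) = nbracket P (us[s := x]) \<oplus>\<^bsub>P\<^esub> nbracket P (us[s := y])"
  and bracket_smult:
    "\<lbrakk>length us = n; set us \<subseteq> carrier P; s < n; c \<in> carrier K; x \<in> carrier P\<rbrakk> \<Longrightarrow>
      nbracket P (us[s := c \<odot>\<^bsub>P\<^esub> x]) = c \<odot>\<^bsub>P\<^esub> nbracket P (us[s := x])"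
  and bracket_alternating:
    "\<lbrakk>length us = n; set us \<subseteq> carrier P; r < n; s < n; r \<noteq> s; us ! r = us ! s\<rbrakk> \<Longrightarrow>
      nbracket P us = \<zero>\<^bsub>P\<^esub>"
  and fundamental_identity:
    "\<lbrakk>length us = n; set us \<subseteq> carrier P; length vs = n - 1; set vs \<subseteq> carrier P\<rbrakk> \<Longrightarrow>
      nbracket P (nbracket P us # vs) =
        (\<Oplus>\<^bsub>P\<^esub>s\<in>{..<n}. nbracket P (us[s := nbracket P (us ! s # vs)]))"
  and bracket_Leibniz:
    "\<lbrakk>length us = n; set us \<subseteq> carrier P; s < n; x \<in> carrier P; y \<in> carrier P\<rbrakk> \<Longrightarrow>
      nbracket P (us[s := x \<otimes>\<^bsub>P\<^esub> y]) =
        (x \<otimes>\<^bsub>P\<^esub> nbracket P (us[s := y])) \<oplus>\<^bsub>P\<^esub> (nbracket P (us[s := x]) \<otimes>\<^bsub>P\<^esub> y)"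

section \<open>Gradings\<close>

locale graded_algebra = algebra K P
  for K :: "('a, 'c) ring_scheme" and P :: "('a, 'b, 'd) module_scheme"
    and A :: "int \<Rightarrow> 'b set" +
  assumes component_subspace: "subspace K (A i) P"
  and direct_sum:
    "x \<in> carrier P \<Longrightarrow>
      \<exists>!f. (\<forall>i. f i \<in> A i) \<and> finite {i. f i \<noteq> \<zero>\<^bsub>P\<^esub>} \<and> x = (\<Oplus>\<^bsub>P\<^esub>i\<in>{i. f i \<noteq> \<zero>\<^bsub>P\<^esub>}. f i)"
  and mult_component: "\<lbrakk>x \<in> A i; y \<in> A j\<rbrakk> \<Longrightarrow> x \<otimes>\<^bsub>P\<^esub> y \<in> A (i + j)"

locale connected_graded_algebra = graded_algebra K P A
  for K :: "('a, 'c) ring_scheme" and P :: "('a, 'b, 'd) module_scheme"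
    and A :: "int \<Rightarrow> 'b set" +
  assumes positive_component: "i > 0 \<Longrightarrow> A i = {\<zero>\<^bsub>P\<^esub>}"
  and zero_component: "A 0 = {c \<odot>\<^bsub>P\<^esub> \<one>\<^bsub>P\<^esub> | c. c \<in> carrier K}"

locale poisson_graded_algebra = nambu_poisson_algebra n K P + graded_algebra K P A
  for n :: nat and w :: int and K :: "('a, 'c) ring_scheme"
    and P :: "('a, 'b, 'd) nambu_alg_scheme" and A :: "int \<Rightarrow> 'b set" +
  assumes bracket_component:
    "\<lbrakk>length is = n; length us = n; \<And>s. s < n \<Longrightarrow> us ! s \<in> A (is ! s)\<rbrakk> \<Longrightarrow>
      nbracket P us \<in> A (sum_list is - w)"

section \<open>Quotients\<close>

text \<open>
  As for \<^const>\<open>rcoset_mult\<close>, the operations on cosets are unions over all representatives; such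
  a union is a single coset exactly when the operation does not depend on the representatives.
\<close>

definition quot_alg :: "('a, 'b, 'm) module_scheme \<Rightarrow> 'b set \<Rightarrow> ('a, 'b set) module" where
  "quot_alg M I = ring.extend (M Quot I)
     (module.fields (\<lambda>c X. \<Union>x\<in>X. I +>\<^bsub>M\<^esub> (c \<odot>\<^bsub>M\<^esub> x)))"

definition quot_nambu :: "('a, 'b, 'm) nambu_alg_scheme \<Rightarrow> 'b set \<Rightarrow> ('a, 'b set) nambu_alg" where
  "quot_nambu M I = module.extend (quot_alg M I)
     (nambu_alg.fields (\<lambda>Xs. \<Union>xs\<in>listset Xs. I +>\<^bsub>M\<^esub> nbracket M xs))"

section \<open>Potentials and their Nambu-Poisson algebras\<close>

definition is_potential :: "nat \<Rightarrow> 'a::field mpoly \<Rightarrow> bool" where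
  "is_potential n \<Omega> \<longleftrightarrow>
     \<Omega> \<in> carrier (poly_alg (n + 1)) \<and> (\<exists>d. homogeneous d \<Omega>) \<and>
     vectorspace.fin_dim class_ring
       (quot_alg (poly_alg (n + 1)) (Idl\<^bsub>poly_alg (n + 1)\<^esub> {partial i \<Omega> | i. i < n + 1}))"

definition A_Omega :: "nat \<Rightarrow> 'a::comm_ring_1 mpoly \<Rightarrow> ('a, 'a mpoly) nambu_alg" where
  "A_Omega n \<Omega> = module.extend (poly_alg (n + 1))
     (nambu_alg.fields (\<lambda>fs. det (mat (n + 1) (n + 1) (\<lambda>(i, j). partial j ((fs @ [\<Omega>]) ! i)))))"

definition P_Omega :: "nat \<Rightarrow> 'a::comm_ring_1 mpoly \<Rightarrow> ('a, 'a mpoly set) nambu_alg" where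
  "P_Omega n \<Omega> = quot_nambu (A_Omega n \<Omega>) (Idl\<^bsub>A_Omega n \<Omega>\<^esub> {\<Omega>})"

end

(*
  The degree grading of the polynomial ring induces the required grading; the fundamental identity
  holds because the vector field {-, v_1, ..., v_(n-1)} is divergence free and kills Omega.

  For uniqueness, let G be another such grading, and write deg_G for minus the degree with respect
  to G. Let a be the maximum of deg_G t_i, and y_i the component of t_i with deg_G = a. The
  derivative Omega_j is up to sign the bracket of the remaining variables, so that
  deg_G Omega_j <= n a + d_0. If a > 1, then this is less than (n + d_0) a, although Omega_j is
  homogeneous of degree n + d_0. Since some power of t_i lies in the Jacobian ideal, y_i is then
  nilpotent, hence 0, because the hypersurface is reduced. So deg_G t_i <= 1, that is t_i = c_i + b_i
  with c_i constant and b_i of degree -1. The bracket ignores c_i, so that Omega_j is homogeneous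
  of degree -(n + d_0) for G, the powers of t_i in the Jacobian ideal have no constant component,
  and c_i = 0. Hence G agrees with the degree grading on the generators.

  For reducedness, let Omega divide g^2 and put x = g / Omega. Differentiating the equation for
  x^k Omega shows inductively that Omega_j x^k Omega is a polynomial. Powers of two variables lie
  in the Jacobian ideal and are coprime, so x^k Omega itself is a polynomial for every k. Thus x is
  almost integral, and therefore a polynomial.
*)

theory Submission
  imports Defs
begin

section \<open>Polynomials\<close>

text \<open>A grading of the quotient is studied through the preimages \<open>G i\<close> of its
  components in the polynomial ring. Each of them contains the ideal of \<Omega>, so that being zero
  becomes being divisible by \<Omega>, and the degree estimates involve no cosets. Grades are
  nonpositive: \<open>f \<in> gsum G {- a..}\<close> says that deg_G f is at most a modulo \<Omega>.
  The descent on a hinges on one number. In an equation t_i^K = sum of c_ij \<Omega>_j with c_ij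
  homogeneous of degree K - (n + d_0), the right-hand side has deg_G at most K a - d_0 (a - 1),
  which is below K a exactly when a > 1. Hence the finite dimension of the Jacobian quotient is used
  in the form of such equations, with homogeneous coefficients and one K for all i; for a = 1 the
  estimate says nothing more, and only the constants remain to be removed. The passage through
  almost integral quotients g / \<Omega> avoids any factorization of \<Omega>: only leading
  monomials are compared.\<close>

lemma lookup_keys_sum:
  fixes f :: "(nat \<Rightarrow>\<^sub>0 nat) \<Rightarrow> 'a::comm_ring_1"
  assumes "finite A"
  shows "Poly_Mapping.lookup (\<Sum>m\<in>A. Poly_Mapping.single m (f m)) k = (if k \<in> A then f k else 0)"
  using assms by (auto simp: lookup_sum lookup_single when_def sum.delta)

lemma sum_monomials:
  fixes p :: "'a::comm_ring_1 mpoly"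
  shows "(\<Sum>m\<in>Poly_Mapping.keys p. Poly_Mapping.single m (Poly_Mapping.lookup p m)) = p"
  by (rule poly_mapping_eqI) (simp add: lookup_keys_sum in_keys_iff)

lemma mpoly_induct [case_names single add]:
  fixes p :: "'a::comm_ring_1 mpoly"
  assumes "\<And>m c. P (Poly_Mapping.single m c)" and "\<And>p q. P p \<Longrightarrow> P q \<Longrightarrow> P (p + q)"
  shows "P p"
proof -
  have "P (\<Sum>m\<in>A. Poly_Mapping.single m (Poly_Mapping.lookup p m))" if "finite A" for A
    using that
  proof (induction A rule: finite_induct)
    case empty
    then show ?case using assms(1)[of 0 0] by simp
  qed (simp add: assms)
  moreover have "(\<Sum>m\<in>Poly_Mapping.keys p. Poly_Mapping.single m (Poly_Mapping.lookup p m)) = p"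
    by (rule sum_monomials)
  ultimately show ?thesis
    using finite_keys[of p] by metis
qed

text \<open>Among the exponents that truncated subtraction sends to \<open>k\<close>, all but
  \<open>k + single i 1\<close> have exponent 0 at \<open>i\<close>, and the factor
  \<open>of_nat\<close> removes their terms. Linearity and commutation of partial derivatives become
  comparisons of coefficients.\<close>

lemma lookup_partial:
  fixes p :: "'a::comm_ring_1 mpoly"
  shows "Poly_Mapping.lookup (partial i p) k =
    of_nat (Poly_Mapping.lookup k i + 1) * Poly_Mapping.lookup p (k + Poly_Mapping.single i 1)"
proof -
  let ?e = "Poly_Mapping.single i (1::nat)"
  have shift: "m = k + ?e" if "m - ?e = k" "Poly_Mapping.lookup m i \<noteq> 0" for m
  proof (rule poly_mapping_eqI)
    fix j
    show "Poly_Mapping.lookup m j = Poly_Mapping.lookup (k + ?e) j"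
      using that by (cases "j = i") (auto simp: lookup_add lookup_minus lookup_single)
  qed
  have "Poly_Mapping.lookup (partial i p) k =
      (\<Sum>m\<in>Poly_Mapping.keys p. if m = k + ?e
         then of_nat (Poly_Mapping.lookup m i) * Poly_Mapping.lookup p m else 0)"
    unfolding partial_def lookup_sum
  proof (rule sum.cong)
    fix m assume "m \<in> Poly_Mapping.keys p"
    show "Poly_Mapping.lookup (Poly_Mapping.single (m - ?e)
        (of_nat (Poly_Mapping.lookup m i) * Poly_Mapping.lookup p m)) k =
      (if m = k + ?e then of_nat (Poly_Mapping.lookup m i) * Poly_Mapping.lookup p m else 0)"
    proof (cases "m = k + ?e")
      case False
      then have "Poly_Mapping.lookup m i = 0 \<or> m - ?e \<noteq> k"
        using shift by blast
      with False show ?thesis by (auto simp: lookup_single when_def)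
    qed (simp add: lookup_single lookup_add)
  qed simp
  also have "\<dots> = of_nat (Poly_Mapping.lookup k i + 1) * Poly_Mapping.lookup p (k + ?e)"
    by (auto simp: sum.delta in_keys_iff lookup_add)
  finally show ?thesis .
qed

lemma partial_add: "partial i (p + q) = partial i p + partial i q"
  by (rule poly_mapping_eqI) (simp only: lookup_partial lookup_add algebra_simps)

lemma partial_zero [simp]: "partial i 0 = 0"
  by (rule poly_mapping_eqI) (simp only: lookup_partial lookup_zero mult_zero_right)

lemma partial_uminus: "partial i (- p) = - partial i p"
  by (rule poly_mapping_eqI) (simp only: lookup_partial lookup_uminus mult_minus_right)

lemma partial_diff: "partial i (p - q) = partial i p - partial i q"
  using partial_add[of i p "- q"] by (simp add: partial_uminus)

lemma partial_sum: "partial i (sum f A) = (\<Sum>x\<in>A. partial i (f x))"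
  by (induction A rule: infinite_finite_induct) (simp_all add: partial_add)

lemma partial_single:
  "partial i (Poly_Mapping.single m c :: 'a::comm_ring_1 mpoly) =
    Poly_Mapping.single (m - Poly_Mapping.single i 1) (of_nat (Poly_Mapping.lookup m i) * c)"
  by (cases "c = 0") (simp_all add: partial_def)

lemma partial_commute: "partial i (partial j p) = partial j (partial i p)"
proof (rule poly_mapping_eqI)
  fix k
  show "Poly_Mapping.lookup (partial i (partial j p)) k = Poly_Mapping.lookup (partial j (partial i p)) k"
  proof (cases "i = j")
    case False
    have "k + Poly_Mapping.single i 1 + Poly_Mapping.single j 1 =
        k + Poly_Mapping.single j 1 + Poly_Mapping.single i 1"
      by (simp only: ac_simps)
    moreover have "Poly_Mapping.lookup (k + Poly_Mapping.single i 1) j = Poly_Mapping.lookup k j"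
      "Poly_Mapping.lookup (k + Poly_Mapping.single j 1) i = Poly_Mapping.lookup k i"
      using False by (simp_all add: lookup_add lookup_single)
    ultimately show ?thesis
      by (simp only: lookup_partial mult.left_commute)
  qed simp
qed

lemma partial_mult: "partial i (p * q) = partial i p * q + p * partial i (q :: 'a::comm_ring_1 mpoly)"
proof (induction p rule: mpoly_induct)
  case (single m c)
  show ?case
  proof (induction q rule: mpoly_induct)
    case (single m' c')
    let ?e = "Poly_Mapping.single i (1::nat)"
    \<comment> \<open>Truncated subtraction is compatible with addition if the exponent at
      \<open>i\<close> is positive; if it is 0, the derivative of the monomial vanishes
      anyway.\<close>
    have l: "m - ?e + m' = m + m' - ?e" if "Poly_Mapping.lookup m i \<noteq> 0" for m m' :: "nat \<Rightarrow>\<^sub>0 nat"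
    proof (rule poly_mapping_eqI)
      fix j
      show "Poly_Mapping.lookup (m - ?e + m') j = Poly_Mapping.lookup (m + m' - ?e) j"
        using that by (cases "j = i") (auto simp: lookup_add lookup_minus lookup_single)
    qed
    have "partial i (Poly_Mapping.single m c) * Poly_Mapping.single m' c' =
        Poly_Mapping.single (m + m' - ?e) (of_nat (Poly_Mapping.lookup m i) * (c * c'))"
      by (cases "Poly_Mapping.lookup m i = 0")
        (simp_all only: partial_single mult_single mult.assoc l of_nat_0 mult_zero_left single_zero not_False_eq_True)
    moreover have "Poly_Mapping.single m c * partial i (Poly_Mapping.single m' c') =
        Poly_Mapping.single (m + m' - ?e) (of_nat (Poly_Mapping.lookup m' i) * (c * c'))"
      using l[of m' m] by (cases "Poly_Mapping.lookup m' i = 0")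
        (simp_all only: partial_single mult_single mult.left_commute add.commute[of m] of_nat_0
          mult_zero_left mult_zero_right single_zero not_False_eq_True)
    moreover have "partial i (Poly_Mapping.single m c * Poly_Mapping.single m' c') =
        Poly_Mapping.single (m + m' - ?e)
          (of_nat (Poly_Mapping.lookup m i) * (c * c') + of_nat (Poly_Mapping.lookup m' i) * (c * c'))"
      by (simp add: partial_single mult_single lookup_add distrib_right)
    ultimately show ?case
      by (simp only: single_add)
  qed (simp add: partial_add distrib_left distrib_right add_ac)
qed (simp add: partial_add distrib_left distrib_right add_ac)

section \<open>Variables, constants and the total degree\<close>

definition var :: "nat \<Rightarrow> 'a::comm_ring_1 mpoly" where
  "var i = Poly_Mapping.single (Poly_Mapping.single i 1) 1"

definition const :: "'a \<Rightarrow> 'a::comm_ring_1 mpoly" where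
  "const c = Poly_Mapping.single 0 c"

lemma partial_var: "partial j (var i) = (if i = j then 1 else 0)"
  by (simp add: var_def partial_single lookup_single single_diff)

lemma partial_const [simp]: "partial j (const c) = 0"
  by (simp add: const_def partial_single)

lemma const_0 [simp]: "const 0 = 0" and const_1 [simp]: "const 1 = 1"
  by (simp_all add: const_def)

lemma const_add: "const (a + b) = const a + const b"
  and const_mult: "const (a * b) = const a * const b"
  by (simp_all add: const_def single_add mult_single)

lemma const_power: "const (a ^ k) = const a ^ k"
  by (induction k) (simp_all add: const_mult)

lemma partial_power: "partial i (p ^ Suc k) = of_nat (Suc k) * p ^ k * partial i p"
  by (induction k) (simp_all add: partial_mult algebra_simps)

definition mdeg :: "(nat \<Rightarrow>\<^sub>0 nat) \<Rightarrow> nat" where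
  "mdeg m = (\<Sum>i\<in>Poly_Mapping.keys m. Poly_Mapping.lookup m i)"

lemma mdeg_superset:
  assumes "finite A" "Poly_Mapping.keys m \<subseteq> A"
  shows "mdeg m = (\<Sum>i\<in>A. Poly_Mapping.lookup m i)"
  unfolding mdeg_def using assms by (intro sum.mono_neutral_left) (auto simp: in_keys_iff)

lemma keys_add_nat: "Poly_Mapping.keys (m + m' :: nat \<Rightarrow>\<^sub>0 nat) = Poly_Mapping.keys m \<union> Poly_Mapping.keys m'"
  by (auto simp: in_keys_iff lookup_add)

lemma mdeg_add: "mdeg (m + m') = mdeg m + mdeg m'"
proof -
  let ?A = "Poly_Mapping.keys m \<union> Poly_Mapping.keys m'"
  have "mdeg (m + m') = (\<Sum>i\<in>?A. Poly_Mapping.lookup (m + m') i)"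
    by (intro mdeg_superset) (auto simp: keys_add_nat)
  also have "\<dots> = mdeg m + mdeg m'"
    by (simp add: lookup_add sum.distrib mdeg_superset[of ?A m] mdeg_superset[of ?A m'])
  finally show ?thesis .
qed

lemma mdeg_single [simp]: "mdeg (Poly_Mapping.single i k) = k"
  by (simp add: mdeg_def)

lemma mdeg_0_iff: "mdeg m = 0 \<longleftrightarrow> m = 0"
  by (auto simp: mdeg_def in_keys_iff intro: poly_mapping_eqI)

lemma lookup_le_mdeg: "Poly_Mapping.lookup m i \<le> mdeg m"
  unfolding mdeg_def
  by (cases "i \<in> Poly_Mapping.keys m") (auto intro: member_le_sum simp: in_keys_iff)

lemma homogeneous_iff: "homogeneous d p \<longleftrightarrow> (\<forall>m\<in>Poly_Mapping.keys p. mdeg m = d)"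
  by (simp add: homogeneous_def mdeg_def)

section \<open>Selecting monomials\<close>

definition filt :: "(nat \<Rightarrow>\<^sub>0 nat) set \<Rightarrow> 'a::comm_ring_1 mpoly \<Rightarrow> 'a mpoly" where
  "filt S p = (\<Sum>m\<in>Poly_Mapping.keys p \<inter> S. Poly_Mapping.single m (Poly_Mapping.lookup p m))"

lemma lookup_filt: "Poly_Mapping.lookup (filt S p) m = (if m \<in> S then Poly_Mapping.lookup p m else 0)"
  by (simp add: filt_def lookup_keys_sum in_keys_iff)

lemma keys_filt: "Poly_Mapping.keys (filt S p) = Poly_Mapping.keys p \<inter> S"
  by (auto simp: in_keys_iff lookup_filt split: if_splits)

lemma filt_add: "filt S (p + q) = filt S p + filt S q"
  and filt_diff: "filt S (p - q) = filt S p - filt S q"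
  and filt_zero [simp]: "filt S 0 = 0"
  and filt_empty [simp]: "filt {} p = 0"
  by (rule poly_mapping_eqI; simp add: lookup_filt lookup_add lookup_minus)+

lemma filt_sum: "filt S (sum f A) = (\<Sum>x\<in>A. filt S (f x))"
  by (induction A rule: infinite_finite_induct) (simp_all add: filt_add)

lemma filt_single: "filt S (Poly_Mapping.single m c) = (if m \<in> S then Poly_Mapping.single m c else 0)"
  by (rule poly_mapping_eqI) (auto simp add: lookup_filt lookup_single when_def)

lemma filt_eq: "Poly_Mapping.keys p \<subseteq> S \<Longrightarrow> filt S p = p"
  by (rule poly_mapping_eqI) (auto simp add: lookup_filt in_keys_iff)

text \<open>Multiplication by \<open>q\<close> carries the monomials of \<open>S'\<close> into
  \<open>S\<close> and the others out of \<open>S\<close>. This is used for the monomials of degree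
  d and d + e, for empty \<open>S'\<close> when the degree is too small, and for the monomials in
  the first \<open>N\<close> variables.\<close>

lemma filt_mult:
  assumes "\<And>m m'. m' \<in> Poly_Mapping.keys q \<Longrightarrow> m + m' \<in> S \<longleftrightarrow> m \<in> S'"
  shows "filt S (p * q) = filt S' p * q"
proof (induction p rule: mpoly_induct)
  case (single m c)
  have q: "q = (\<Sum>m'\<in>Poly_Mapping.keys q. Poly_Mapping.single m' (Poly_Mapping.lookup q m'))"
    by (rule sum_monomials[symmetric])
  have "filt S (Poly_Mapping.single m c * q) =
      (\<Sum>m'\<in>Poly_Mapping.keys q. filt S (Poly_Mapping.single (m + m') (c * Poly_Mapping.lookup q m')))"
    by (subst q) (simp add: sum_distrib_left filt_sum mult_single)
  also have "\<dots> = (\<Sum>m'\<in>Poly_Mapping.keys q.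
      filt S' (Poly_Mapping.single m c) * Poly_Mapping.single m' (Poly_Mapping.lookup q m'))"
    using assms by (intro sum.cong) (auto simp: filt_single mult_single)
  also have "\<dots> = filt S' (Poly_Mapping.single m c) * q"
    by (simp only: q[symmetric] flip: sum_distrib_left)
  finally show ?case .
qed (simp add: filt_add distrib_right)

section \<open>Homogeneous components\<close>

definition hcomp :: "nat \<Rightarrow> 'a::comm_ring_1 mpoly \<Rightarrow> 'a mpoly" where
  "hcomp d = filt {m. mdeg m = d}"

lemma hcomp_diff: "hcomp d (p - q) = hcomp d p - hcomp d q"
  and hcomp_zero [simp]: "hcomp d 0 = 0"
  and hcomp_sum: "hcomp d (sum f A) = (\<Sum>x\<in>A. hcomp d (f x))"
  by (simp_all add: hcomp_def filt_diff filt_sum)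

lemma homogeneous_hcomp: "homogeneous d (hcomp d p)"
  by (auto simp: homogeneous_iff hcomp_def keys_filt)

lemma hcomp_homogeneous:
  assumes "homogeneous e p"
  shows "hcomp d p = (if d = e then p else 0)"
  using assms
  by (intro poly_mapping_eqI) (auto simp: hcomp_def lookup_filt homogeneous_iff in_keys_iff)

lemma hcomp_mult_homogeneous:
  assumes "homogeneous e q"
  shows "hcomp (d + e) (p * q) = hcomp d p * q"
  unfolding hcomp_def using assms by (intro filt_mult) (auto simp: homogeneous_iff mdeg_add)

lemma hcomp_mult_homogeneous_less:
  assumes "homogeneous e q" "d < e"
  shows "hcomp d (p * q) = 0"
  using filt_mult[of q "{m. mdeg m = d}" "{}" p] assms
  by (auto simp: homogeneous_iff mdeg_add hcomp_def)

lemma sum_hcomp: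
  assumes "\<And>m. m \<in> Poly_Mapping.keys p \<Longrightarrow> mdeg m < b"
  shows "(\<Sum>d<b. hcomp d p) = p"
proof (rule poly_mapping_eqI)
  fix m
  show "Poly_Mapping.lookup (\<Sum>d<b. hcomp d p) m = Poly_Mapping.lookup p m"
    using assms[of m]
    by (auto simp: hcomp_def lookup_sum lookup_filt sum.delta' in_keys_iff)
qed

lemma mdeg_bound: "\<exists>b. \<forall>m\<in>Poly_Mapping.keys (p :: 'a::zero mpoly). mdeg m < b"
  by (rule exI[of _ "Suc (Max (insert 0 (mdeg ` Poly_Mapping.keys p)))"]) (auto simp: less_Suc_eq_le)

lemma homogeneous_const [simp]: "homogeneous 0 (const c)"
  by (simp add: homogeneous_iff const_def mdeg_def)

lemma homogeneous_var [simp]: "homogeneous 1 (var i)"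
  by (simp add: homogeneous_iff var_def)

lemma homogeneous_mult:
  assumes "homogeneous d p" "homogeneous e q"
  shows "homogeneous (d + e) (p * q)"
  using assms keys_mult[of p q] by (fastforce simp: homogeneous_iff mdeg_add)

lemma homogeneous_power: "homogeneous d p \<Longrightarrow> homogeneous (k * d) (p ^ k)"
  by (induction k) (use homogeneous_const[of 1] in \<open>simp_all add: homogeneous_mult\<close>)

lemma homogeneous_partial:
  assumes "homogeneous (Suc d) p"
  shows "homogeneous d (partial i p)"
proof -
  have "mdeg m = d" if "m \<in> Poly_Mapping.keys (partial i p)" for m
  proof -
    have "Poly_Mapping.lookup p (m + Poly_Mapping.single i 1) \<noteq> 0"
      using that by (auto simp: in_keys_iff lookup_partial)
    then have "mdeg (m + Poly_Mapping.single i 1) = Suc d"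
      using assms by (auto simp: homogeneous_iff in_keys_iff)
    then show ?thesis by (simp add: mdeg_add)
  qed
  then show ?thesis by (simp add: homogeneous_iff)
qed

section \<open>Polynomials in finitely many variables\<close>

definition polys :: "nat \<Rightarrow> 'a::comm_ring_1 mpoly set" where
  "polys N = carrier (poly_alg N)"

lemma polys_iff: "p \<in> polys N \<longleftrightarrow> (\<forall>m\<in>Poly_Mapping.keys p. Poly_Mapping.keys m \<subseteq> {..<N})"
  by (simp add: polys_def poly_alg_def)

lemma polys_zero [simp]: "0 \<in> polys N" and polys_one [simp]: "1 \<in> polys N"
  and polys_const [simp]: "const c \<in> polys N"
  by (simp_all add: polys_iff const_def)

lemma polys_var: "i < N \<Longrightarrow> var i \<in> polys N"
  by (simp add: polys_iff var_def)

lemma polys_add: "p \<in> polys N \<Longrightarrow> q \<in> polys N \<Longrightarrow> p + q \<in> polys N"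
  unfolding polys_iff using keys_add[of p q] by blast

lemma polys_uminus [simp]: "- p \<in> polys N \<longleftrightarrow> p \<in> polys N"
  by (simp add: polys_iff in_keys_iff)

lemma polys_diff: "p \<in> polys N \<Longrightarrow> q \<in> polys N \<Longrightarrow> p - q \<in> polys N"
  using polys_add[of p N "- q"] by simp

lemma polys_mult: "p \<in> polys N \<Longrightarrow> q \<in> polys N \<Longrightarrow> p * q \<in> polys N"
  unfolding polys_iff using keys_mult[of p q] by (fastforce simp: keys_add_nat)

lemma polys_power: "p \<in> polys N \<Longrightarrow> p ^ k \<in> polys N"
  by (induction k) (auto intro: polys_mult)

lemma polys_sum: "(\<And>x. x \<in> A \<Longrightarrow> f x \<in> polys N) \<Longrightarrow> sum f A \<in> polys N"
  by (induction A rule: infinite_finite_induct) (auto intro: polys_add)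

lemma polys_prod: "(\<And>x. x \<in> A \<Longrightarrow> f x \<in> polys N) \<Longrightarrow> prod f A \<in> polys N"
  by (induction A rule: infinite_finite_induct) (auto intro: polys_mult)

lemma polys_partial:
  assumes "p \<in> polys N"
  shows "partial i p \<in> polys N"
  unfolding polys_iff
proof
  fix m assume "m \<in> Poly_Mapping.keys (partial i p)"
  then have "m + Poly_Mapping.single i 1 \<in> Poly_Mapping.keys p"
    by (auto simp: in_keys_iff lookup_partial)
  then have "Poly_Mapping.keys (m + Poly_Mapping.single i 1) \<subseteq> {..<N}"
    using assms unfolding polys_iff by blast
  then show "Poly_Mapping.keys m \<subseteq> {..<N}"
    unfolding keys_add_nat by simp
qed

lemma polys_filt: "p \<in> polys N \<Longrightarrow> filt S p \<in> polys N"
  by (auto simp: polys_iff keys_filt)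

lemma polys_hcomp: "p \<in> polys N \<Longrightarrow> hcomp d p \<in> polys N"
  by (simp add: hcomp_def polys_filt)

text \<open>Divisibility refers to the whole type, whose polynomials may involve variables of any
  index. Discarding the monomials with an index beyond \<open>N\<close> is linear over
  \<open>polys N\<close>, so that a quotient can be chosen in \<open>polys N\<close>.\<close>

definition restr :: "nat \<Rightarrow> 'a::comm_ring_1 mpoly \<Rightarrow> 'a mpoly" where
  "restr N = filt {m. Poly_Mapping.keys m \<subseteq> {..<N}}"

lemma restr_polys: "restr N p \<in> polys N"
  by (auto simp: restr_def polys_iff keys_filt)

lemma restr_eq: "p \<in> polys N \<Longrightarrow> restr N p = p"
  by (auto simp: restr_def polys_iff intro: filt_eq)

lemma restr_mult: "q \<in> polys N \<Longrightarrow> restr N (p * q) = restr N p * q"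
  unfolding restr_def by (rule filt_mult) (auto simp: polys_iff keys_add_nat)

lemma dvd_polys:
  assumes "q dvd p" "p \<in> polys N" "q \<in> polys N"
  obtains r where "r \<in> polys N" "p = r * q"
proof -
  obtain r where "p = r * q"
    using assms(1) by (metis dvd_def mult.commute)
  then have "p = restr N r * q"
    using restr_mult[OF assms(3)] restr_eq[OF assms(2)] by metis
  then show ?thesis using that restr_polys by blast
qed

text \<open>Makes the ideal of a homogeneous polynomial a graded ideal, so that the degree grading
  descends to the quotient.\<close>

lemma dvd_hcomp:
  assumes "homogeneous e q" "q dvd p"
  shows "q dvd hcomp d p"
proof -
  obtain r where r: "p = r * q"
    using assms(2) by (metis dvd_def mult.commute)
  show ?thesis
  proof (cases "d < e")
    case False
    then show ?thesis
      using hcomp_mult_homogeneous[OF assms(1), of "d - e" r] by (simp add: r)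
  qed (simp add: r hcomp_mult_homogeneous_less[OF assms(1)])
qed

text \<open>Passes a property indexed by the degree from the variables to all forms. Zero is
  homogeneous of every degree, hence the case \<open>zero\<close> for all \<open>d\<close>.\<close>

lemma homogeneous_induct [consumes 2, case_names zero add const var]:
  assumes "homogeneous d p" "p \<in> polys N"
    and zero: "\<And>d. P d 0" and add: "\<And>d p q. P d p \<Longrightarrow> P d q \<Longrightarrow> P d (p + q)"
    and const: "\<And>c. P 0 (const c)"
    and var: "\<And>d i p. i < N \<Longrightarrow> P d p \<Longrightarrow> P (Suc d) (var i * p)"
  shows "P d p"
proof -
  have mon: "P d (Poly_Mapping.single m c)"
    if "mdeg m = d" "Poly_Mapping.keys m \<subseteq> {..<N}" for m c
    using that
  proof (induction d arbitrary: m)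
    case 0
    then show ?case using const[of c] by (simp add: mdeg_0_iff const_def)
  next
    case (Suc d)
    then have "m \<noteq> 0" by (auto simp: mdeg_def)
    then obtain i where i: "i \<in> Poly_Mapping.keys m" by (metis all_not_in_conv keys_eq_empty)
    let ?e = "Poly_Mapping.single i (1::nat)"
    have m: "m = ?e + (m - ?e)"
      using i by (intro poly_mapping_eqI) (auto simp: lookup_add lookup_minus lookup_single when_def in_keys_iff)
    have "mdeg m = 1 + mdeg (m - ?e)"
      by (subst m) (simp add: mdeg_add)
    moreover have "Poly_Mapping.keys (m - ?e) \<subseteq> {..<N}"
      using Suc.prems(2) m keys_add_nat by (metis Un_subset_iff)
    ultimately have "P (Suc d) (var i * Poly_Mapping.single (m - ?e) c)"
      using Suc i by (intro var Suc.IH) auto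
    moreover have "var i * Poly_Mapping.single (m - ?e) c = Poly_Mapping.single m c"
      using m by (simp add: var_def mult_single)
    ultimately show ?case by simp
  qed
  have "P d (\<Sum>m\<in>A. Poly_Mapping.single m (Poly_Mapping.lookup p m))"
    if "A \<subseteq> Poly_Mapping.keys p" for A
    using finite_subset[OF that finite_keys] that
  proof (induction A rule: finite_induct)
    case (insert m A)
    have "P d (Poly_Mapping.single m (Poly_Mapping.lookup p m))"
      using insert.prems assms(1,2) by (intro mon) (auto simp: homogeneous_iff polys_iff)
    then show ?case using insert add by simp
  qed (simp add: zero)
  moreover have "(\<Sum>m\<in>Poly_Mapping.keys p. Poly_Mapping.single m (Poly_Mapping.lookup p m)) = p"
    by (rule sum_monomials)
  ultimately show ?thesis by (metis order_refl)
qed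

section \<open>Determinants and derivations\<close>

text \<open>The entries are given by a function, so that replacing row \<open>s\<close> is the
  update \<open>F(s := r)\<close>.\<close>

definition dt :: "nat \<Rightarrow> (nat \<Rightarrow> nat \<Rightarrow> 'b) \<Rightarrow> 'b::comm_ring_1" where
  "dt N F = det (mat N N (\<lambda>(i, j). F i j))"

definition cf :: "nat \<Rightarrow> (nat \<Rightarrow> nat \<Rightarrow> 'b) \<Rightarrow> nat \<Rightarrow> nat \<Rightarrow> 'b::comm_ring_1" where
  "cf N F s j = cofactor (mat N N (\<lambda>(i, j). F i j)) s j"

lemma dt_leibniz:
  "dt N F = (\<Sum>p | p permutes {0..<N}. signof p * (\<Prod>i = 0..<N. F i (p i)))"
proof -
  have "(\<Prod>i = 0..<N. mat N N (\<lambda>(i, j). F i j) $$ (i, p i)) = (\<Prod>i = 0..<N. F i (p i))"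
    if "p permutes {0..<N}" for p
    using permutes_in_image[OF that] by (intro prod.cong) auto
  then show ?thesis
    by (simp add: dt_def det_def'[of _ N])
qed

lemma dt_cong: "(\<And>i j. i < N \<Longrightarrow> j < N \<Longrightarrow> F i j = G i j) \<Longrightarrow> dt N F = dt N G"
  unfolding dt_def by (intro arg_cong[of _ _ det] eq_matI) auto

lemma cf_update: "s < N \<Longrightarrow> j < N \<Longrightarrow> cf N (F(s := r)) s j = cf N F s j"
  unfolding cf_def cofactor_def mat_delete_def
  by (intro arg_cong2[of _ _ _ _ "(*)"] arg_cong[of _ _ det] eq_matI) auto

lemma dt_expand_row: "s < N \<Longrightarrow> dt N F = (\<Sum>j<N. F s j * cf N F s j)"
  unfolding dt_def cf_def by (subst laplace_expansion_row[of _ N s]) auto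

lemma dt_expand: "s < N \<Longrightarrow> dt N (F(s := r)) = (\<Sum>j<N. r j * cf N F s j)"
  by (subst dt_expand_row) (auto intro!: sum.cong simp: cf_update simp del: fun_upd_apply simp: fun_upd_same)

lemma dt_add: "s < N \<Longrightarrow> dt N (F(s := \<lambda>j. u j + v j)) = dt N (F(s := u)) + dt N (F(s := v))"
  and dt_diff: "s < N \<Longrightarrow> dt N (F(s := \<lambda>j. u j - v j)) = dt N (F(s := u)) - dt N (F(s := v))"
  and dt_zero_row: "s < N \<Longrightarrow> dt N (F(s := \<lambda>j. 0)) = 0"
  by (simp_all add: dt_expand algebra_simps sum.distrib sum_subtractf)

text \<open>With cofactors written as determinants, \<open>derivation_dt\<close> and
  \<open>dt_swap\<close> apply to them.\<close>

lemma cf_eq_dt: "s < N \<Longrightarrow> k < N \<Longrightarrow> cf N F s k = dt N (F(s := \<lambda>j. if j = k then 1 else 0))"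
  by (simp add: dt_expand if_distrib[of "\<lambda>x. x * _"] sum.delta cong: if_cong)

lemma dt_identical_rows: "r < N \<Longrightarrow> s < N \<Longrightarrow> r \<noteq> s \<Longrightarrow> F r = F s \<Longrightarrow> dt N F = 0"
  unfolding dt_def by (rule det_identical_rows[of _ N r s]) (auto intro!: eq_vecI)

text \<open>Polarization: expand the determinant with \<open>u + v\<close> in both rows, where equal
  rows give zero.\<close>

lemma dt_swap:
  assumes "r < N" "s < N" "r \<noteq> s"
  shows "dt N (F(r := u, s := v)) + dt N (F(r := v, s := u)) = 0"
proof -
  let ?w = "\<lambda>j. u j + v j"
  have eq: "dt N (F(r := x, s := x)) = 0" for x
    using assms by (intro dt_identical_rows[of r _ s]) auto
  have add_r: "dt N (F(r := ?w, s := x)) = dt N (F(r := u, s := x)) + dt N (F(r := v, s := x))" for x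
    using dt_add[of r N "F(s := x)" u v] assms by (simp add: fun_upd_twist)
  have "0 = dt N (F(r := ?w, s := ?w))" by (simp add: eq)
  also have "\<dots> = dt N (F(r := ?w, s := u)) + dt N (F(r := ?w, s := v))"
    using assms by (intro dt_add)
  also have "\<dots> = dt N (F(r := u, s := v)) + dt N (F(r := v, s := u))"
    by (simp add: add_r eq)
  finally show ?thesis by simp
qed

text \<open>The derivative of \<open>det (F (1 + \<epsilon> A))\<close> at \<open>\<epsilon> = 0\<close>.\<close>

lemma sum_dt_mult_row:
  "(\<Sum>s<N. dt N (F(s := \<lambda>j. \<Sum>k<N. F s k * A k j))) = (\<Sum>k<N. A k k) * dt N F"
proof -
  let ?M = "mat N N (\<lambda>(i, j). F i j)"
  have adj: "(\<Sum>s<N. cf N F s j * F s k) = (if j = k then dt N F else 0)" if "j < N" "k < N" for j k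
  proof -
    have "(adj_mat ?M * ?M) $$ (j, k) = (det ?M \<cdot>\<^sub>m 1\<^sub>m N) $$ (j, k)"
      by (subst adj_mat(3)) auto
    then show ?thesis
      using that by (simp add: adj_mat_def scalar_prod_def cf_def dt_def atLeast0LessThan)
  qed
  have "(\<Sum>s<N. dt N (F(s := \<lambda>j. \<Sum>k<N. F s k * A k j))) =
      (\<Sum>s<N. \<Sum>j<N. \<Sum>k<N. A k j * (cf N F s j * F s k))"
    by (simp add: dt_expand sum_distrib_left sum_distrib_right mult_ac)
  also have "\<dots> = (\<Sum>j<N. \<Sum>s<N. \<Sum>k<N. A k j * (cf N F s j * F s k))"
    by (rule sum.swap)
  also have "\<dots> = (\<Sum>j<N. \<Sum>k<N. \<Sum>s<N. A k j * (cf N F s j * F s k))"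
    by (intro sum.cong sum.swap refl)
  also have "\<dots> = (\<Sum>j<N. \<Sum>k<N. A k j * (if j = k then dt N F else 0))"
    by (simp add: adj flip: sum_distrib_left)
  also have "\<dots> = (\<Sum>k<N. A k k) * dt N F"
    by (simp add: if_distrib[of "\<lambda>x. _ * x"] sum.delta' sum_distrib_right cong: if_cong)
  finally show ?thesis .
qed

section \<open>Derivations and their action on determinants\<close>

definition derivation :: "('b \<Rightarrow> 'b::comm_ring_1) \<Rightarrow> bool" where
  "derivation D \<longleftrightarrow> (\<forall>x y. D (x + y) = D x + D y) \<and> (\<forall>x y. D (x * y) = D x * y + x * D y)"

lemma derivation_add: "derivation D \<Longrightarrow> D (x + y) = D x + D y"
  and derivation_mult: "derivation D \<Longrightarrow> D (x * y) = D x * y + x * D y"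
  by (simp_all add: derivation_def)

lemma derivation_0: "derivation D \<Longrightarrow> D 0 = 0"
  using derivation_add[of D 0 0] by simp

lemma derivation_1: "derivation D \<Longrightarrow> D 1 = 0"
  using derivation_mult[of D 1 1] by simp

lemma derivation_uminus: "derivation D \<Longrightarrow> D (- x) = - D x"
  using derivation_add[of D x "- x"] derivation_0[of D] by (simp add: eq_neg_iff_add_eq_0 add.commute)

lemma derivation_sum: "derivation D \<Longrightarrow> D (sum f A) = (\<Sum>x\<in>A. D (f x))"
  by (induction A rule: infinite_finite_induct) (simp_all add: derivation_add derivation_0)

lemma derivation_prod:
  assumes "derivation D" "finite A"
  shows "D (prod f A) = (\<Sum>s\<in>A. \<Prod>i\<in>A. if i = s then D (f i) else f i)"
  using assms(2)
proof (induction A rule: finite_induct)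
  case (insert a A)
  have 1: "(\<Prod>i\<in>A. if i = a then D (f i) else f i) = prod f A"
    using insert.hyps by (intro prod.cong) auto
  have 2: "(\<Prod>i\<in>insert a A. if i = s then D (f i) else f i) =
      f a * (\<Prod>i\<in>A. if i = s then D (f i) else f i)" if "s \<in> A" for s
    using that insert.hyps by auto
  have "(\<Sum>s\<in>insert a A. \<Prod>i\<in>insert a A. if i = s then D (f i) else f i) =
      D (f a) * prod f A + (\<Sum>s\<in>A. f a * (\<Prod>i\<in>A. if i = s then D (f i) else f i))"
    unfolding sum.insert[OF insert.hyps]
  proof (rule arg_cong2[of _ _ _ _ "(+)"])
    show "(\<Prod>i\<in>insert a A. if i = a then D (f i) else f i) = D (f a) * prod f A"
      using insert.hyps by (simp add: 1)
  qed (rule sum.cong[OF refl 2])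
  then show ?case
    using insert by (simp add: derivation_mult[OF assms(1)] sum_distrib_left)
qed (simp add: derivation_1[OF assms(1)])

lemma derivation_dt:
  assumes "derivation D"
  shows "D (dt N F) = (\<Sum>s<N. dt N (F(s := \<lambda>j. D (F s j))))"
proof -
  have sgn: "D (signof p * x) = signof p * D x" for p x
    by (simp add: sign_def derivation_uminus[OF assms])
  have "D (dt N F) = (\<Sum>p | p permutes {0..<N}. \<Sum>s = 0..<N.
      signof p * (\<Prod>i = 0..<N. (F(s := \<lambda>j. D (F s j))) i (p i)))"
    by (simp add: dt_leibniz derivation_sum[OF assms] sgn derivation_prod[OF assms] sum_distrib_left)
      (intro sum.cong arg_cong2[of _ _ _ _ "(*)"] prod.cong refl; auto)
  also have "\<dots> = (\<Sum>s = 0..<N. dt N (F(s := \<lambda>j. D (F s j))))"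
    by (subst sum.swap) (simp add: dt_leibniz)
  finally show ?thesis by (simp add: atLeast0LessThan)
qed

lemma derivation_partial: "derivation (partial i)"
  by (simp add: derivation_def partial_add partial_mult)

section \<open>The Jacobian bracket\<close>

definition br :: "nat \<Rightarrow> 'a::comm_ring_1 mpoly \<Rightarrow> 'a mpoly list \<Rightarrow> 'a mpoly" where
  "br n \<Omega> fs = dt (n + 1) (\<lambda>i j. partial j ((fs @ [\<Omega>]) ! i))"

text \<open>Expansion along row \<open>s\<close>, whose cofactors do not involve \<open>x\<close>:
  in each argument the bracket is a vector field with fixed coefficients. Additivity, the Leibniz
  rule and the vanishing on constants follow from this.\<close>

lemma br_update:
  assumes "length us = n" "s < n"
  shows "br n \<Omega> (us[s := x]) =
    (\<Sum>j<n + 1. partial j x * cf (n + 1) (\<lambda>i j. partial j ((us @ [\<Omega>]) ! i)) s j)"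
proof -
  have "(\<lambda>i j. partial j ((us[s := x] @ [\<Omega>]) ! i)) =
      (\<lambda>i j. partial j ((us @ [\<Omega>]) ! i))(s := \<lambda>j. partial j x)"
    using assms by (intro ext) (auto simp: nth_append nth_list_update)
  then show ?thesis
    using assms by (simp only: br_def dt_expand trans_less_add1)
qed

lemma br_add:
  assumes "length us = n" "s < n"
  shows "br n \<Omega> (us[s := x + y]) = br n \<Omega> (us[s := x]) + br n \<Omega> (us[s := y])"
  using assms by (simp add: br_update partial_add distrib_right sum.distrib del: sum.lessThan_Suc)

lemma br_mult:
  assumes "length us = n" "s < n"
  shows "br n \<Omega> (us[s := x * y]) = x * br n \<Omega> (us[s := y]) + br n \<Omega> (us[s := x]) * y"
  using assms by (simp add: br_update partial_mult distrib_right sum.distrib sum_distrib_left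
      sum_distrib_right mult_ac add.commute del: sum.lessThan_Suc)

lemma br_const:
  assumes "length us = n" "s < n"
  shows "br n \<Omega> (us[s := const c]) = 0"
  using assms by (simp add: br_update)

lemma br_const_mult:
  assumes "length us = n" "s < n"
  shows "br n \<Omega> (us[s := const c * x]) = const c * br n \<Omega> (us[s := x])"
  using assms by (simp add: br_mult br_const)

lemma br_alternating:
  assumes "length us = n" "r < n" "s < n" "r \<noteq> s" "us ! r = us ! s"
  shows "br n \<Omega> us = 0"
  unfolding br_def using assms
  by (intro dt_identical_rows[of r _ s]) (auto simp: nth_append)

lemma br_potential:
  assumes "length us = n" "s < n" "us ! s = \<Omega>"
  shows "br n \<Omega> us = 0"
  unfolding br_def using assms
  by (intro dt_identical_rows[of s _ n]) (auto simp: nth_append)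

lemma br_polys:
  assumes "length us = n" "set us \<subseteq> polys N" "\<Omega> \<in> polys N"
  shows "br n \<Omega> us \<in> polys N"
proof -
  have sgn: "signof p * x \<in> polys N" if "x \<in> polys N" for p and x :: "'a mpoly"
    using that by (simp add: sign_def)
  have "(us @ [\<Omega>]) ! i \<in> polys N" if "i < n + 1" for i
    using assms that by (auto simp: nth_append less_Suc_eq)
  then show ?thesis
    unfolding br_def dt_leibniz
    by (intro polys_sum sgn polys_prod polys_partial) auto
qed

lemma sum_symmetric_antisymmetric:
  fixes X :: "nat \<Rightarrow> nat \<Rightarrow> 'b::{idom, ring_char_0}"
  assumes "\<And>j k. j < N \<Longrightarrow> k < N \<Longrightarrow> h j k = h k j" and "\<And>j k. j < N \<Longrightarrow> k < N \<Longrightarrow> X j k + X k j = 0"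
  shows "(\<Sum>j<N. \<Sum>k<N. h j k * X j k) = 0"
proof -
  let ?S = "\<Sum>j<N. \<Sum>k<N. h j k * X j k"
  have "?S = (\<Sum>j<N. \<Sum>k<N. h k j * X k j)"
    by (rule sum.swap)
  then have "?S + ?S = (\<Sum>j<N. \<Sum>k<N. h j k * X j k + h k j * X k j)"
    by (simp add: sum.distrib)
  also have "\<dots> = 0"
    using assms by (intro sum.neutral ballI) (simp flip: distrib_left)
  finally show ?thesis
    by (simp flip: mult_2)
qed

text \<open>A Hamiltonian vector field is divergence free, because the second partial derivatives are
  symmetric and the determinant is antisymmetric.\<close>

lemma divergence_cofactors:
  fixes ws :: "'a::field_char_0 mpoly list"
  assumes "0 < N"
  defines "G \<equiv> \<lambda>i j. partial j (ws ! i)"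
  shows "(\<Sum>k<N. partial k (cf N G 0 k)) = 0"
proof -
  define e :: "nat \<Rightarrow> nat \<Rightarrow> 'a mpoly" where "e k = (\<lambda>j. if j = k then 1 else 0)" for k
  have e: "partial i (e k j) = 0" for i j k
    by (simp add: e_def flip: const_1)
  have row: "dt N ((G(0 := e k))(s := \<lambda>j. partial k ((G(0 := e k)) s j))) =
      (if s = 0 then 0 else \<Sum>j<N. partial k (G s j) * dt N (G(0 := e k, s := e j)))"
    if "k < N" "s < N" for k s
  proof (cases "s = 0")
    case True
    then show ?thesis using assms dt_zero_row[of 0 N] by (simp add: e)
  next
    case False
    then show ?thesis
      using that by (subst dt_expand) (auto simp: cf_eq_dt e_def)
  qed
  have "(\<Sum>k<N. partial k (cf N G 0 k)) =
      (\<Sum>k<N. \<Sum>s<N. if s = 0 then 0 else \<Sum>j<N. partial k (G s j) * dt N (G(0 := e k, s := e j)))"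
  proof (rule sum.cong)
    fix k assume k: "k \<in> {..<N}"
    have "cf N G 0 k = dt N (G(0 := e k))"
      using k assms(1) by (simp add: cf_eq_dt e_def)
    then have "partial k (cf N G 0 k) =
        (\<Sum>s<N. dt N ((G(0 := e k))(s := \<lambda>j. partial k ((G(0 := e k)) s j))))"
      by (simp only: derivation_dt[OF derivation_partial])
    also have "\<dots> = (\<Sum>s<N. if s = 0 then 0
        else \<Sum>j<N. partial k (G s j) * dt N (G(0 := e k, s := e j)))"
      using k by (intro sum.cong refl row) auto
    finally show "partial k (cf N G 0 k) = (\<Sum>s<N. if s = 0 then 0
        else \<Sum>j<N. partial k (G s j) * dt N (G(0 := e k, s := e j)))" .
  qed simp
  also have "\<dots> = (\<Sum>s<N. if s = 0 then 0 else
      \<Sum>k<N. \<Sum>j<N. partial k (G s j) * dt N (G(0 := e k, s := e j)))"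
    by (subst sum.swap) (intro sum.cong refl; simp)
  also have "\<dots> = 0"
  proof (intro sum.neutral ballI)
    fix s assume s: "s \<in> {..<N}"
    have "(\<Sum>k<N. \<Sum>j<N. partial k (G s j) * dt N (G(0 := e k, s := e j))) = 0" if "s \<noteq> 0"
      using s that assms dt_swap[of 0 N s G]
      by (intro sum_symmetric_antisymmetric) (auto simp: G_def partial_commute)
    then show "(if s = 0 then 0 else
      \<Sum>k<N. \<Sum>j<N. partial k (G s j) * dt N (G(0 := e k, s := e j))) = 0"
      by simp
  qed
  finally show ?thesis .
qed

text \<open>\<open>D\<close> differentiates the Jacobian matrix row by row. Commuting it with
  \<open>partial j\<close> changes each row by its product with the matrix of derivatives of the
  coefficients \<open>a k\<close>; by \<open>sum_dt_mult_row\<close> these corrections add up to the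
  divergence of \<open>D\<close> times the determinant.\<close>

lemma br_fundamental_identity:
  fixes \<Omega> :: "'a::field_char_0 mpoly"
  assumes us: "length us = n" and vs: "length vs = n - 1" and "0 < n"
  shows "br n \<Omega> (br n \<Omega> us # vs) = (\<Sum>s<n. br n \<Omega> (us[s := br n \<Omega> (us ! s # vs)]))"
proof -
  let ?N = "n + 1"
  define D where "D f = br n \<Omega> (f # vs)" for f
  \<comment> \<open>The entry 0 holds the place of the argument of \<open>D\<close>; the cofactors
    of row 0 do not see it.\<close>
  define a where "a k = cf ?N (\<lambda>i j. partial j ((0 # vs @ [\<Omega>]) ! i)) 0 k" for k
  define F where "F = (\<lambda>i j. partial j ((us @ [\<Omega>]) ! i))"
  have D: "D f = (\<Sum>k<?N. partial k f * a k)" for f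
    using br_update[of "0 # vs" n 0 \<Omega> f] assms by (simp add: D_def a_def)
  have der: "derivation D"
    unfolding derivation_def D
    by (simp add: partial_add partial_mult sum.distrib sum_distrib_left algebra_simps
        del: sum.lessThan_Suc)
  have div: "(\<Sum>k<?N. partial k (a k)) = 0"
    unfolding a_def by (rule divergence_cofactors) simp
  have D\<Omega>: "D \<Omega> = 0"
    unfolding D_def using assms by (intro br_potential[of _ _ 0]) auto
  have comm: "D (partial j f) = partial j (D f) - (\<Sum>k<?N. partial k f * partial j (a k))" for j f
    by (simp add: D partial_sum partial_mult sum.distrib partial_commute del: sum.lessThan_Suc)
  have "D (br n \<Omega> us) = (\<Sum>s<?N. dt ?N (F(s := \<lambda>j. D (F s j))))"
    using derivation_dt[OF der] by (simp only: br_def F_def)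
  also have "\<dots> = (\<Sum>s<?N. dt ?N (F(s := \<lambda>j. partial j (D ((us @ [\<Omega>]) ! s))))
      - dt ?N (F(s := \<lambda>j. \<Sum>k<?N. F s k * partial j (a k))))"
    by (intro sum.cong refl) (simp only: F_def comm dt_diff lessThan_iff)
  also have "\<dots> = (\<Sum>s<?N. dt ?N (F(s := \<lambda>j. partial j (D ((us @ [\<Omega>]) ! s)))))"
    unfolding sum_subtractf sum_dt_mult_row div by simp
  also have "\<dots> = (\<Sum>s<n. dt ?N (F(s := \<lambda>j. partial j (D ((us @ [\<Omega>]) ! s)))))
      + dt ?N (F(n := \<lambda>j. partial j (D \<Omega>)))"
    using us by (simp add: nth_append)
  also have "\<dots> = (\<Sum>s<n. dt ?N (F(s := \<lambda>j. partial j (D ((us @ [\<Omega>]) ! s)))))"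
    by (simp add: D\<Omega> dt_zero_row)
  also have "\<dots> = (\<Sum>s<n. br n \<Omega> (us[s := D (us ! s)]))"
    unfolding br_def using us
    by (intro sum.cong refl dt_cong) (auto simp: F_def nth_append nth_list_update)
  finally show ?thesis by (simp only: D_def)
qed

section \<open>Leading monomials\<close>

text \<open>\<open>Max\<close> refers to the linear order on exponents, which is compatible with
  addition. The value at 0 is unspecified.\<close>

definition lm :: "'a::zero mpoly \<Rightarrow> nat \<Rightarrow>\<^sub>0 nat" where
  "lm p = Max (Poly_Mapping.keys p)"

lemma lookup_single_mult:
  fixes p :: "'a::comm_ring_1 mpoly"
  shows "Poly_Mapping.lookup (Poly_Mapping.single m c * p) (m + k) = c * Poly_Mapping.lookup p k"
  by (induction p rule: mpoly_induct) (auto simp: mult_single lookup_single when_def lookup_add distrib_left)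

lemma lm_in_keys: "p \<noteq> 0 \<Longrightarrow> lm p \<in> Poly_Mapping.keys p"
  by (simp add: lm_def)

lemma lm_ge: "m \<in> Poly_Mapping.keys p \<Longrightarrow> m \<le> lm p"
  by (simp add: lm_def)

lemma lm_eqI: "m \<in> Poly_Mapping.keys p \<Longrightarrow> (\<And>k. k \<in> Poly_Mapping.keys p \<Longrightarrow> k \<le> m) \<Longrightarrow> lm p = m"
  unfolding lm_def by (intro Max_eqI) auto

lemma lm_mult:
  fixes p q :: "'a::idom mpoly"
  assumes "p \<noteq> 0" "q \<noteq> 0"
  shows "lm (p * q) = lm p + lm q"
proof (rule lm_eqI)
  let ?s = "\<lambda>p. Poly_Mapping.single (lm p) (Poly_Mapping.lookup p (lm p)) :: 'a mpoly"
  \<comment> \<open>\<open>?s r\<close> is the leading term, and the rest of \<open>r\<close> has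
    only smaller monomials; hence just the product of the two leading terms reaches
    \<open>lm p + lm q\<close>.\<close>
  have less: "k < lm r" if "k \<in> Poly_Mapping.keys (r - ?s r)" for k and r :: "'a mpoly"
  proof -
    have "k \<noteq> lm r" using that by (auto simp: in_keys_iff lookup_minus)
    then have "k \<in> Poly_Mapping.keys r"
      using that by (auto simp: in_keys_iff lookup_minus lookup_single when_def split: if_splits)
    with \<open>k \<noteq> lm r\<close> show ?thesis
      using lm_ge by (metis order_le_imp_less_or_eq)
  qed
  have "lm p + lm q \<notin> Poly_Mapping.keys (?s p * (q - ?s q))"
  proof
    assume "lm p + lm q \<in> Poly_Mapping.keys (?s p * (q - ?s q))"
    then obtain a b where "lm p + lm q = a + b" "a \<in> Poly_Mapping.keys (?s p)"
      "b \<in> Poly_Mapping.keys (q - ?s q)"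
      using keys_mult by blast
    then show False using less[of b q] by (auto split: if_splits)
  qed
  moreover have "lm p + lm q \<notin> Poly_Mapping.keys ((p - ?s p) * q)"
  proof
    assume "lm p + lm q \<in> Poly_Mapping.keys ((p - ?s p) * q)"
    then obtain a b where "lm p + lm q = a + b" "a \<in> Poly_Mapping.keys (p - ?s p)"
      "b \<in> Poly_Mapping.keys q"
      using keys_mult by blast
    then show False using less[of a p] lm_ge[of b q] add_less_le_mono[of a "lm p" b "lm q"] by auto
  qed
  moreover have split: "p * q = ?s p * ?s q + ?s p * (q - ?s q) + (p - ?s p) * q"
    by (simp add: algebra_simps)
  have "Poly_Mapping.lookup (p * q) (lm p + lm q) = Poly_Mapping.lookup (?s p * ?s q) (lm p + lm q) +
      Poly_Mapping.lookup (?s p * (q - ?s q)) (lm p + lm q) +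
      Poly_Mapping.lookup ((p - ?s p) * q) (lm p + lm q)"
    using arg_cong[OF split, of "\<lambda>r. Poly_Mapping.lookup r (lm p + lm q)"] by (simp only: lookup_add)
  ultimately have "Poly_Mapping.lookup (p * q) (lm p + lm q) =
      Poly_Mapping.lookup p (lm p) * Poly_Mapping.lookup q (lm q)"
    by (simp only: in_keys_iff not_not mult_single lookup_single_eq add_0_right)
  then show "lm p + lm q \<in> Poly_Mapping.keys (p * q)"
    using lm_in_keys[OF assms(1)] lm_in_keys[OF assms(2)] by (simp add: in_keys_iff)
next
  fix k assume "k \<in> Poly_Mapping.keys (p * q)"
  then obtain a b where "k = a + b" "a \<in> Poly_Mapping.keys p" "b \<in> Poly_Mapping.keys q"
    using keys_mult by blast
  then show "k \<le> lm p + lm q"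
    by (simp add: add_mono lm_ge)
qed

lemma lookup_lm_power:
  fixes p :: "'a::idom mpoly"
  assumes "p \<noteq> 0"
  shows "Poly_Mapping.lookup (lm (p ^ k)) i = k * Poly_Mapping.lookup (lm p) i"
proof (induction k)
  case 0
  have "lm (1 :: 'a mpoly) = 0" by (rule lm_eqI) auto
  then show ?case by simp
qed (simp add: assms lm_mult lookup_add)

lemma lm_single_mult:
  fixes p :: "'a::idom mpoly"
  assumes "c \<noteq> 0" "p \<noteq> 0"
  shows "lm (Poly_Mapping.single m c * p) = m + lm p"
proof -
  have "Poly_Mapping.single m c \<noteq> 0"
    using assms(1) by (metis lookup_single_eq lookup_zero)
  moreover have "lm (Poly_Mapping.single m c) = m"
    using assms(1) by (intro lm_eqI) auto
  ultimately show ?thesis using assms(2) by (simp add: lm_mult)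
qed

text \<open>If \<open>g / q\<close> is almost integral over the polynomial ring, then the leading monomial of \<open>q\<close>
  divides that of \<open>g\<close>.\<close>

lemma lm_le_of_power_dvd:
  fixes q :: "'a::idom mpoly"
  assumes dvd: "\<And>k. q ^ k dvd g ^ Suc k" and "q \<noteq> 0" "g \<noteq> 0"
  shows "Poly_Mapping.lookup (lm q) i \<le> Poly_Mapping.lookup (lm g) i"
proof (rule ccontr)
  assume "\<not> ?thesis"
  \<comment> \<open>If \<open>lm g\<close> has exponent k - 1 and \<open>lm q\<close> has exponent
    at least k, then comparing exponents in g^(k + 1) = q^k r gives k k \<le> (k + 1) (k - 1), which
    is absurd.\<close>
  moreover define k where "k = Suc (Poly_Mapping.lookup (lm g) i)"
  ultimately have le: "k \<le> Poly_Mapping.lookup (lm q) i" by simp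
  obtain r where r: "g ^ Suc k = q ^ k * r"
    using dvd[of k] by (elim dvdE)
  then have "r \<noteq> 0" using assms(3) by (metis mult_zero_right power_not_zero)
  then have "Suc k * Poly_Mapping.lookup (lm g) i = k * Poly_Mapping.lookup (lm q) i + Poly_Mapping.lookup (lm r) i"
    using r assms(2,3) by (metis lm_mult lookup_add lookup_lm_power power_not_zero)
  then have "k * Poly_Mapping.lookup (lm q) i \<le> Suc k * Poly_Mapping.lookup (lm g) i"
    by simp
  moreover have "k * k \<le> k * Poly_Mapping.lookup (lm q) i"
    using le by simp
  moreover have "Suc k * Poly_Mapping.lookup (lm g) i < k * k"
    by (simp add: k_def)
  ultimately show False by linarith
qed

text \<open>Subtracting a polynomial from g / q keeps it almost integral: in the binomial expansion,
  a term with g^i (h q)^(k + 1 - i) and i \<ge> 1 is divisible by q^(i - 1) q^(k + 1 - i) =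
  q^k.\<close>

lemma power_dvd_diff_mult:
  fixes q :: "'b::comm_ring_1"
  assumes "\<And>k. q ^ k dvd g ^ Suc k"
  shows "q ^ k dvd (g - h * q) ^ Suc k"
proof -
  have dvd: "q ^ i dvd (- h * q) ^ i" for i
    unfolding power_mult_distrib by simp
  have "q ^ k dvd of_nat (Suc k choose i) * g ^ i * (- h * q) ^ (Suc k - i)" if "i \<le> Suc k" for i
  proof (cases i)
    case 0
    moreover have "q ^ k dvd (- h * q) ^ Suc k"
      using dvd[of k] by (simp only: power_Suc dvd_mult)
    ultimately show ?thesis by (simp only: diff_zero dvd_mult)
  next
    case (Suc j)
    have "q ^ (j + (k - j)) dvd g ^ Suc j * (- h * q) ^ (k - j)"
      unfolding power_add by (intro mult_dvd_mono assms dvd)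
    then show ?thesis using Suc that by (simp add: mult.assoc dvd_mult)
  qed
  then have "q ^ k dvd (g + - h * q) ^ Suc k"
    unfolding binomial_ring by (intro dvd_sum) auto
  then show ?thesis by simp
qed

lemma finite_monomials: "finite {m. Poly_Mapping.keys m \<subseteq> {..<N} \<and> mdeg m < b}"
proof (rule finite_subset)
  let ?A = "{xs. set xs \<subseteq> {..<b} \<and> length xs = N}"
  let ?f = "\<lambda>xs. Abs_poly_mapping (\<lambda>i. if i < N then xs ! i else 0)"
  show "{m. Poly_Mapping.keys m \<subseteq> {..<N} \<and> mdeg m < b} \<subseteq> ?f ` ?A"
  proof
    fix m :: "nat \<Rightarrow>\<^sub>0 nat" assume m: "m \<in> {m. Poly_Mapping.keys m \<subseteq> {..<N} \<and> mdeg m < b}"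
    have "Poly_Mapping.lookup m i < b" for i
      using m lookup_le_mdeg[of m i] by simp
    then have "map (Poly_Mapping.lookup m) [0..<N] \<in> ?A" by auto
    moreover have "m = ?f (map (Poly_Mapping.lookup m) [0..<N])"
      using m by (intro poly_mapping_eqI) (auto simp: in_keys_iff subset_iff)
    ultimately show "m \<in> ?f ` ?A" by blast
  qed
qed (intro finite_imageI finite_lists_length_eq finite_lessThan)

text \<open>Take a counterexample with the smallest leading monomial and cancel its leading term by
  a multiple of \<open>q\<close>; the result is a smaller counterexample. As \<open>q\<close> is
  homogeneous, this multiple is a form of the degree of \<open>lm f\<close>, so that all monomials
  stay within the finite set \<open>E\<close>, which guarantees that a minimum exists.\<close>

lemma almost_integral_dvd:
  fixes q :: "'a::field mpoly"
  assumes "q \<noteq> 0" "homogeneous d q" "q \<in> polys N"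
    and "g \<in> polys N" "\<And>k. q ^ k dvd g ^ Suc k"
  shows "q dvd g"
proof (rule ccontr)
  assume "\<not> q dvd g"
  obtain b where b: "\<forall>m\<in>Poly_Mapping.keys g. mdeg m < b"
    using mdeg_bound by blast
  define E where "E = {m. Poly_Mapping.keys m \<subseteq> {..<N} \<and> mdeg m < b}"
  define X where "X = {g. Poly_Mapping.keys g \<subseteq> E \<and> (\<forall>k. q ^ k dvd g ^ Suc k) \<and> \<not> q dvd g}"
  have "g \<in> X"
    using assms(4,5) b \<open>\<not> q dvd g\<close> by (auto simp: X_def E_def polys_iff)
  have nz: "f \<noteq> 0" if "f \<in> X" for f using that by (auto simp: X_def)
  have "lm ` X \<subseteq> E"
  proof
    fix m assume "m \<in> lm ` X"
    then obtain f where f: "f \<in> X" "m = lm f" by blast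
    then show "m \<in> E" using lm_in_keys[OF nz[OF f(1)]] by (auto simp: X_def)
  qed
  then have "finite (lm ` X)" using finite_monomials by (simp add: E_def finite_subset)
  moreover have "lm ` X \<noteq> {}" using \<open>g \<in> X\<close> by blast
  ultimately have "Min (lm ` X) \<in> lm ` X" by (rule Min_in)
  then obtain f where f: "f \<in> X" and min: "\<And>f'. f' \<in> X \<Longrightarrow> lm f \<le> lm f'"
    using \<open>finite (lm ` X)\<close> by (metis (no_types, lifting) Min_le image_iff)
  have lmE: "lm f \<in> E" using f \<open>lm ` X \<subseteq> E\<close> by blast
  define c where "c = Poly_Mapping.lookup f (lm f) / Poly_Mapping.lookup q (lm q)"
  define t where "t = Poly_Mapping.single (lm f - lm q) c"
  have c0: "c \<noteq> 0"
    using lm_in_keys[OF assms(1)] lm_in_keys[OF nz[OF f]] by (simp add: c_def in_keys_iff)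
  have dvd_f: "q ^ k dvd f ^ Suc k" for k
    using f by (simp add: X_def)
  have le: "Poly_Mapping.lookup (lm q) i \<le> Poly_Mapping.lookup (lm f) i" for i
    using dvd_f assms(1) nz[OF f] by (rule lm_le_of_power_dvd)
  have split: "lm f - lm q + lm q = lm f"
    using le by (intro poly_mapping_eqI) (simp add: lookup_add lookup_minus)
  have lmt: "lm (t * q) = lm f"
    unfolding t_def using c0 assms(1) split by (simp add: lm_single_mult)
  have degt: "mdeg (lm f - lm q) + d = mdeg (lm f)"
    using split assms(2) lm_in_keys[OF assms(1)] by (metis homogeneous_iff mdeg_add)
  have keyst: "Poly_Mapping.keys (t * q) \<subseteq> E"
  proof
    fix m assume "m \<in> Poly_Mapping.keys (t * q)"
    then obtain m' where m': "m = lm f - lm q + m'" "m' \<in> Poly_Mapping.keys q"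
      using keys_mult[of t q] by (auto simp: t_def split: if_splits)
    then have "mdeg m = mdeg (lm f)"
      using degt assms(2) by (simp add: mdeg_add homogeneous_iff)
    moreover have "Poly_Mapping.keys (lm f - lm q) \<subseteq> {..<N}"
      using lmE split by (metis (mono_tags, lifting) E_def Un_subset_iff keys_add_nat mem_Collect_eq)
    moreover have "Poly_Mapping.keys m' \<subseteq> {..<N}"
      using m' assms(3) by (simp add: polys_iff)
    ultimately show "m \<in> E" using lmE m'(1) by (simp add: E_def keys_add_nat)
  qed
  have "f - t * q \<in> X"
  proof -
    have "Poly_Mapping.keys (f - t * q) \<subseteq> Poly_Mapping.keys f \<union> Poly_Mapping.keys (t * q)"
      by (auto simp: in_keys_iff lookup_minus)
    then have "Poly_Mapping.keys (f - t * q) \<subseteq> E"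
      using f keyst by (auto simp: X_def)
    moreover have "q ^ k dvd (f - t * q) ^ Suc k" for k
      using dvd_f by (rule power_dvd_diff_mult)
    moreover have "\<not> q dvd f - t * q"
      using f by (simp add: X_def dvd_diff_left_iff)
    ultimately show ?thesis by (simp add: X_def)
  qed
  have "lm (f - t * q) < lm f"
  proof -
    have "Poly_Mapping.lookup (t * q) (lm f) = c * Poly_Mapping.lookup q (lm q)"
      unfolding t_def using split lookup_single_mult[of "lm f - lm q" c q "lm q"] by simp
    also have "\<dots> = Poly_Mapping.lookup f (lm f)"
      using lm_in_keys[OF assms(1)] by (simp add: c_def in_keys_iff)
    finally have "lm f \<notin> Poly_Mapping.keys (f - t * q)"
      by (simp add: in_keys_iff lookup_minus)
    moreover have "lm (f - t * q) \<in> Poly_Mapping.keys (f - t * q)"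
      using nz[OF \<open>f - t * q \<in> X\<close>] by (rule lm_in_keys)
    moreover from this have "lm (f - t * q) \<in> Poly_Mapping.keys f \<union> Poly_Mapping.keys (t * q)"
      by (auto simp: in_keys_iff lookup_minus)
    then have "lm (f - t * q) \<le> lm f"
      using lm_ge lmt by (metis Un_iff)
    ultimately show ?thesis by (metis order_le_less)
  qed
  then show False using min[OF \<open>f - t * q \<in> X\<close>] by simp
qed

section \<open>Reducedness of the hypersurface\<close>

lemma var_power: "var i ^ k = Poly_Mapping.single (Poly_Mapping.single i k) 1"
  by (induction k) (simp_all add: var_def mult_single flip: single_add)

text \<open>Each monomial of \<open>a\<close>, times t_i^k, occurs in a multiple of t_j^k, and t_i^k
  contributes nothing to the exponent at \<open>j\<close>.\<close>

lemma var_power_dvd: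
  fixes a b :: "'a::comm_ring_1 mpoly"
  assumes "var i ^ k * a = var j ^ k * b" "i \<noteq> j"
  shows "var j ^ k dvd a"
proof -
  have "Poly_Mapping.single (Poly_Mapping.single j k) 1 dvd Poly_Mapping.single m (Poly_Mapping.lookup a m)"
    if "m \<in> Poly_Mapping.keys a" for m
  proof -
    have "Poly_Mapping.lookup (var i ^ k * a) (Poly_Mapping.single i k + m) \<noteq> 0"
      using that by (simp add: var_power lookup_single_mult in_keys_iff)
    then have "Poly_Mapping.single i k + m \<in> Poly_Mapping.keys (var j ^ k * b)"
      by (simp add: assms(1) in_keys_iff)
    then obtain r where "Poly_Mapping.single i k + m = Poly_Mapping.single j k + r"
      using keys_mult[of "var j ^ k" b] by (fastforce simp: var_power split: if_splits)
    then have "Poly_Mapping.lookup (Poly_Mapping.single i k + m) j = Poly_Mapping.lookup (Poly_Mapping.single j k + r) j"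
      by simp
    then have "k \<le> Poly_Mapping.lookup m j"
      using assms(2) by (simp add: lookup_add lookup_single)
    then have "m = Poly_Mapping.single j k + (m - Poly_Mapping.single j k)"
      by (intro poly_mapping_eqI) (auto simp: lookup_add lookup_minus lookup_single when_def)
    then show ?thesis
      by (metis dvd_triv_left mult_1 mult_single)
  qed
  then have "Poly_Mapping.single (Poly_Mapping.single j k) 1 dvd
      (\<Sum>m\<in>Poly_Mapping.keys a. Poly_Mapping.single m (Poly_Mapping.lookup a m))"
    by (rule dvd_sum)
  moreover have "(\<Sum>m\<in>Poly_Mapping.keys a. Poly_Mapping.single m (Poly_Mapping.lookup a m)) = a"
    by (rule sum_monomials)
  ultimately show ?thesis by (simp add: var_power)
qed

text \<open>Cancelling \<open>q\<close> from the two factorizations leaves an equation between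
  multiples of powers of two variables, so that coprimality is applied to these monomials and not to
  \<open>q\<close>.\<close>

lemma dvd_of_dvd_var_power_mult:
  fixes q :: "'a::idom mpoly"
  assumes "q \<noteq> 0" "q dvd var i ^ k * f" "q dvd var j ^ k * f" "i \<noteq> j"
  shows "q dvd f"
proof -
  obtain a b where a: "var i ^ k * f = q * a" and b: "var j ^ k * f = q * b"
    using assms(2,3) by (metis dvdE)
  have "q * (var i ^ k * b) = var i ^ k * (var j ^ k * f)"
    unfolding b by (rule mult.left_commute)
  also have "\<dots> = q * (var j ^ k * a)"
    unfolding mult.left_commute[of "var i ^ k" "var j ^ k" f] a by (rule mult.left_commute)
  finally have "q * (var i ^ k * b) = q * (var j ^ k * a)" .
  then have "var j ^ k * a = var i ^ k * b"
    using assms(1) by simp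
  then have "var i ^ k dvd a"
    using assms(4) by (intro var_power_dvd[of j]) auto
  then obtain r where "a = var i ^ k * r" by (elim dvdE)
  with a have eq: "var i ^ k * f = var i ^ k * (q * r)"
    by (simp add: mult.left_commute)
  have "var i ^ k \<noteq> (0 :: 'a mpoly)"
    by (metis lookup_single_eq lookup_zero var_power zero_neq_one)
  then have "f = q * r"
    using eq mult_left_cancel by blast
  then show ?thesis by simp
qed

text \<open>With \<open>\<lambda> = g / \<Omega>\<close>, the derivative of \<open>p \<Omega>\<^sup>k\<^sup>+\<^sup>1 = g\<^sup>k\<^sup>+\<^sup>2\<close> shows that the partial
  derivatives of \<open>\<Omega>\<close> multiply \<open>p \<lambda>\<close> into the polynomials.\<close>

lemma dvd_mult_partial:
  fixes \<Omega> :: "'a::field_char_0 mpoly"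
  assumes "\<Omega> \<noteq> 0" and p: "p * \<Omega> ^ Suc k = g ^ Suc (Suc k)"
  shows "\<Omega> dvd p * g * partial j \<Omega>"
proof -
  let ?d = "partial j"
  have "?d p * \<Omega> ^ Suc k + p * (of_nat (Suc k) * \<Omega> ^ k * ?d \<Omega>) = of_nat (Suc (Suc k)) * g ^ Suc k * ?d g"
    using arg_cong[OF p, of ?d] by (simp only: partial_mult partial_power)
  \<comment> \<open>The factor \<open>g\<close> completes the power on the right to g^(k + 2), which
    the assumption turns into p \<Omega>^(k + 1); after cancelling \<Omega>^k, one factor \<Omega>
    remains.\<close>
  then have "g * (?d p * \<Omega> ^ Suc k + p * (of_nat (Suc k) * \<Omega> ^ k * ?d \<Omega>)) =
      of_nat (Suc (Suc k)) * g ^ Suc (Suc k) * ?d g"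
    by (simp only: power_Suc mult_ac)
  then have "g * (?d p * \<Omega> ^ Suc k + p * (of_nat (Suc k) * \<Omega> ^ k * ?d \<Omega>)) =
      of_nat (Suc (Suc k)) * (p * \<Omega> ^ Suc k) * ?d g"
    by (simp only: p)
  then have "\<Omega> ^ k * (of_nat (Suc k) * (p * g * ?d \<Omega>)) =
      \<Omega> ^ k * (\<Omega> * (of_nat (Suc (Suc k)) * p * ?d g - g * ?d p))"
    by (simp add: algebra_simps)
  then have "\<Omega> dvd of_nat (Suc k) * (p * g * ?d \<Omega>)"
    using assms(1) by (simp add: dvd_def)
  \<comment> \<open>Characteristic 0 makes k + 1 invertible.\<close>
  then have "\<Omega> dvd const (inverse (of_nat (Suc k))) * (of_nat (Suc k) * (p * g * ?d \<Omega>))"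
    by (rule dvd_mult)
  moreover have "const (inverse (of_nat (Suc k))) * of_nat (Suc k) = (1 :: 'a mpoly)"
  proof -
    have "of_nat (Suc k) = (const (of_nat (Suc k)) :: 'a mpoly)"
      by (simp only: const_def single_of_nat)
    then show ?thesis
      by (metis const_1 const_mult left_inverse of_nat_neq_0)
  qed
  ultimately show ?thesis
    by (simp only: mult.assoc[symmetric] mult_1)
qed

lemma hypersurface_reduced:
  fixes \<Omega> :: "'a::field_char_0 mpoly"
  assumes "\<Omega> \<noteq> 0" "homogeneous d \<Omega>" "\<Omega> \<in> polys N" "2 \<le> N"
    and jac: "\<And>i. i < N \<Longrightarrow> var i ^ K = (\<Sum>j<N. c i j * partial j \<Omega>)"
    and "g \<in> polys N" "\<Omega> dvd g ^ m"
  shows "\<Omega> dvd g"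
proof -
  have step: "\<Omega> dvd p * g" if "p * \<Omega> ^ Suc k = g ^ Suc (Suc k)" for p g k
  proof -
    have "\<Omega> dvd c i j * partial j \<Omega> * (p * g)" for i j
      using dvd_mult[OF dvd_mult_partial[OF assms(1) that], of "c i j" j] by (simp only: mult_ac)
    then have "\<Omega> dvd var i ^ K * (p * g)" if "i < N" for i
      unfolding jac[OF that] sum_distrib_right by (rule dvd_sum)
    \<comment> \<open>The variables with index 0 and 1 are the two with coprime powers; they exist
      because \<open>2 \<le> N\<close>.\<close>
    then show ?thesis
      using assms(1,4) by (intro dvd_of_dvd_var_power_mult[of \<Omega> 0 K "p * g" 1]) auto
  qed
  have square: "\<Omega> dvd g" if g: "g \<in> polys N" "\<Omega> dvd g ^ 2" for g
  proof -
    have "\<Omega> ^ Suc k dvd g ^ Suc (Suc k)" for k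
    proof (induction k)
      case 0
      then show ?case using g(2) by (simp add: power2_eq_square)
    next
      case (Suc k)
      then obtain p where p: "p * \<Omega> ^ Suc k = g ^ Suc (Suc k)"
        by (metis dvd_def mult.commute)
      then have "\<Omega> * \<Omega> ^ Suc k dvd (p * g) * \<Omega> ^ Suc k"
        by (intro mult_dvd_mono step) auto
      also have "(p * g) * \<Omega> ^ Suc k = g * g ^ Suc (Suc k)"
        by (simp only: p[symmetric] mult_ac)
      finally show ?case by simp
    qed
    then have "\<Omega> ^ k dvd g ^ Suc k" for k
      by (cases k) auto
    then show ?thesis
      using almost_integral_dvd[OF assms(1-3) g(1)] by blast
  qed
  \<comment> \<open>Repeated use of \<open>square\<close> takes the exponent 2^k down to 1, and
    every exponent \<open>m\<close> is below 2^m.\<close>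
  have "\<Omega> dvd g ^ (2 ^ k) \<Longrightarrow> \<Omega> dvd g" for k
  proof (induction k)
    case (Suc k)
    then have "\<Omega> dvd (g ^ 2 ^ k) ^ 2"
      by (simp flip: power_mult add: mult.commute)
    then show ?case using Suc.IH square[of "g ^ 2 ^ k"] assms(6) by (simp add: polys_power)
  qed simp
  moreover have "\<Omega> dvd g ^ 2 ^ m"
    using assms(7) less_exp[of m] by (meson dvd_trans le_imp_power_dvd less_imp_le)
  ultimately show ?thesis by blast
qed

section \<open>Brackets of the variables\<close>

lemma dt_one: "dt N (\<lambda>i j. if j = i then 1 else 0) = 1"
proof -
  have "dt N (\<lambda>i j. if j = i then 1 else 0) = det (1\<^sub>m N)"
    unfolding dt_def by (intro arg_cong[of _ _ det] eq_matI) auto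
  then show ?thesis by simp
qed

text \<open>Up to constants, the list consists of all variables except for the one with index \<open>j\<close>.\<close>

lemma br_variables:
  assumes "j \<le> n"
  defines "\<sigma> \<equiv> \<lambda>s. if s = j then n else s"
  shows "br n \<Omega> (map (\<lambda>s. var (\<sigma> s) - const (c (\<sigma> s))) [0..<n]) \<in> {partial j \<Omega>, - partial j \<Omega>}"
proof -
  let ?us = "map (\<lambda>s. var (\<sigma> s) - const (c (\<sigma> s))) [0..<n]"
  define e :: "nat \<Rightarrow> nat \<Rightarrow> 'a mpoly" where "e k = (\<lambda>j. if j = k then 1 else 0)" for k
  define F where "F = (\<lambda>i. if i < n then e (\<sigma> i) else (\<lambda>k. partial k \<Omega>))"
  have "br n \<Omega> ?us = dt (n + 1) F"
    unfolding br_def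
    by (intro dt_cong) (auto simp: F_def e_def nth_append partial_diff partial_var)
  also have "\<dots> = (\<Sum>k<n + 1. partial k \<Omega> * cf (n + 1) F n k)"
    by (subst dt_expand_row[of n]) (simp_all add: F_def)
  also have "\<dots> = (\<Sum>k<n + 1. if k = j then partial j \<Omega> * cf (n + 1) F n j else 0)"
  proof (intro sum.cong refl)
    fix k assume k: "k \<in> {..<n + 1}"
    \<comment> \<open>The gradient of t_k is already a row, namely row k, or row j if k = n;
      replacing the last row by \<open>e k\<close> repeats it.\<close>
    have "cf (n + 1) F n k = 0" if "k \<noteq> j"
    proof -
      let ?r = "if k = n then j else k"
      have r: "?r < n" "\<sigma> ?r = k" using k that assms(1) by (auto simp: \<sigma>_def)
      have "dt (n + 1) (F(n := e k)) = 0"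
        using r by (intro dt_identical_rows[of ?r _ n]) (auto simp: F_def simp del: if_split)
      then show ?thesis using k by (simp add: cf_eq_dt e_def)
    qed
    then show "partial k \<Omega> * cf (n + 1) F n k =
      (if k = j then partial j \<Omega> * cf (n + 1) F n j else 0)"
      by simp
  qed
  also have "\<dots> = partial j \<Omega> * cf (n + 1) F n j"
    using assms(1) by (simp add: sum.delta del: sum.lessThan_Suc)
  finally have br: "br n \<Omega> ?us = partial j \<Omega> * cf (n + 1) F n j" .
  have one: "dt (n + 1) e = 1"
    unfolding e_def by (rule dt_one)
  have "cf (n + 1) F n j = dt (n + 1) (F(n := e j))"
    using assms(1) by (simp add: cf_eq_dt e_def)
  \<comment> \<open>The rows form the identity matrix if j = n, and otherwise the identity matrix
    with rows j and n interchanged. This is the sign that the statement leaves open.\<close>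
  also have "dt (n + 1) (F(n := e j)) = 1 \<or> dt (n + 1) (F(n := e j)) = - 1"
  proof (cases "j = n")
    case True
    have "dt (n + 1) (F(n := e j)) = dt (n + 1) e"
      using True by (intro dt_cong) (auto simp: F_def \<sigma>_def)
    then show ?thesis using one by simp
  next
    case False
    have "dt (n + 1) (F(n := e j)) = dt (n + 1) (e(j := e n, n := e j))"
      using False by (intro dt_cong) (auto simp: F_def \<sigma>_def)
    moreover have "dt (n + 1) (e(j := e j, n := e n)) = 1"
      using one by simp
    ultimately show ?thesis
      using dt_swap[of j "n + 1" n e "e j" "e n"] False assms(1) by (simp add: eq_neg_iff_add_eq_0 add.commute)
  qed
  finally show ?thesis using br by auto
qed

section \<open>Gradings of a hypersurface, lifted to the polynomial ring\<close>

text \<open>The set \<open>L\<close> selects the grades that may occur: \<open>{- a..}\<close>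
  bounds deg_G by a, and \<open>{..<0}\<close> excludes a constant component, both up to multiples
  of \<Omega> once every \<open>G i\<close> contains them.\<close>

inductive_set gsum :: "(int \<Rightarrow> 'a::comm_ring_1 mpoly set) \<Rightarrow> int set \<Rightarrow> 'a mpoly set"
  for G :: "int \<Rightarrow> 'a mpoly set" and L :: "int set" where
  zero: "0 \<in> gsum G L"
| add: "\<lbrakk>i \<in> L; x \<in> G i; f \<in> gsum G L\<rbrakk> \<Longrightarrow> x + f \<in> gsum G L"

text \<open>The sign is chosen because connected gradings live in nonpositive degrees; for positive
  \<open>i\<close> only zero is left.\<close>

definition std :: "nat \<Rightarrow> int \<Rightarrow> 'a::comm_ring_1 mpoly set" where
  "std N i = {p \<in> polys N. \<forall>m\<in>Poly_Mapping.keys p. int (mdeg m) = - i}"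

text \<open>The set \<open>G i\<close> is the preimage in the polynomial ring of the component of degree \<open>i\<close>.\<close>

locale lifted_grading =
  fixes n d\<^sub>0 K :: nat and \<Omega> :: "'a::field_char_0 mpoly"
    and c :: "nat \<Rightarrow> nat \<Rightarrow> 'a mpoly" and G :: "int \<Rightarrow> 'a mpoly set"
  assumes n_pos: "1 \<le> n" and d\<^sub>0_pos: "1 \<le> d\<^sub>0"
    and \<Omega>_nonzero: "\<Omega> \<noteq> 0" and \<Omega>_hom: "homogeneous (n + 1 + d\<^sub>0) \<Omega>" and \<Omega>_polys: "\<Omega> \<in> polys (n + 1)"
    and K_ge: "n + d\<^sub>0 \<le> K"
    and jac: "\<And>i. i < n + 1 \<Longrightarrow> var i ^ K = (\<Sum>j<n + 1. c i j * partial j \<Omega>)"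
    and c_polys: "\<And>i j. c i j \<in> polys (n + 1)"
    and c_hom: "\<And>i j. homogeneous (K - (n + d\<^sub>0)) (c i j)"
    and G_polys: "\<And>i. G i \<subseteq> polys (n + 1)"
    and G_ideal: "\<And>i f. f \<in> polys (n + 1) \<Longrightarrow> \<Omega> dvd f \<Longrightarrow> f \<in> G i"
    and G_add: "\<And>i f g. f \<in> G i \<Longrightarrow> g \<in> G i \<Longrightarrow> f + g \<in> G i"
    and G_mult: "\<And>i j f g. f \<in> G i \<Longrightarrow> g \<in> G j \<Longrightarrow> f * g \<in> G (i + j)"
    and G_const: "\<And>a. const a \<in> G 0"
    and G_span: "\<And>f. f \<in> polys (n + 1) \<Longrightarrow> f \<in> gsum G UNIV"
    and G_indep: "\<And>S h i. \<lbrakk>finite S; \<And>i. i \<in> S \<Longrightarrow> h i \<in> G i; \<Omega> dvd sum h S; i \<in> S\<rbrakk> \<Longrightarrow> \<Omega> dvd h i"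
    and G_pos: "\<And>i f. i > 0 \<Longrightarrow> f \<in> G i \<Longrightarrow> \<Omega> dvd f"
    and G_zero: "\<And>f. f \<in> G 0 \<Longrightarrow> \<exists>a. \<Omega> dvd f - const a"
    and G_br: "\<And>is us. \<lbrakk>length is = n; length us = n; \<And>s. s < n \<Longrightarrow> us ! s \<in> G (is ! s)\<rbrakk> \<Longrightarrow>
      br n \<Omega> us \<in> G (sum_list is - int d\<^sub>0)"
begin

section \<open>Sums of components\<close>

lemma G_0 [simp]: "0 \<in> G i"
  by (rule G_ideal) auto

lemma G_uminus: "f \<in> G i \<Longrightarrow> - f \<in> G i"
  using G_mult[OF G_const[of "- 1"], of f i] by (simp add: const_def single_uminus)

lemma G_power: "f \<in> G i \<Longrightarrow> f ^ k \<in> G (int k * i)"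
  by (induction k) (use G_const[of 1] in \<open>auto dest: G_mult simp: algebra_simps\<close>)

lemma gsum_mono: "f \<in> gsum G L \<Longrightarrow> L \<subseteq> L' \<Longrightarrow> f \<in> gsum G L'"
  by (induction rule: gsum.induct) (auto intro: gsum.intros)

lemma gsum_component: "i \<in> L \<Longrightarrow> x \<in> G i \<Longrightarrow> x \<in> gsum G L"
  using gsum.add[of i L x G 0] gsum.zero[of G L] by simp

lemma gsum_ideal: "f \<in> polys (n + 1) \<Longrightarrow> \<Omega> dvd f \<Longrightarrow> i \<in> L \<Longrightarrow> f \<in> gsum G L"
  using G_ideal gsum_component by blast

lemma gsum_add: "f \<in> gsum G L \<Longrightarrow> g \<in> gsum G L \<Longrightarrow> f + g \<in> gsum G L"
  by (induction rule: gsum.induct) (auto intro: gsum.intros simp: add.assoc)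

lemma gsum_uminus: "f \<in> gsum G L \<Longrightarrow> - f \<in> gsum G L"
proof (induction rule: gsum.induct)
  case (add i x f)
  then show ?case using gsum.add[of i L "- x" G "- f"] G_uminus by simp
qed (simp add: gsum.zero)

lemma gsum_diff: "f \<in> gsum G L \<Longrightarrow> g \<in> gsum G L \<Longrightarrow> f - g \<in> gsum G L"
  using gsum_add[of f L "- g"] gsum_uminus by simp

lemma gsum_sum: "(\<And>x. x \<in> A \<Longrightarrow> f x \<in> gsum G L) \<Longrightarrow> sum f A \<in> gsum G L"
  by (induction A rule: infinite_finite_induct) (auto intro: gsum_add gsum.zero)

lemma gsum_mult:
  assumes "f \<in> gsum G L" "g \<in> gsum G L'" and sub: "\<And>i j. i \<in> L \<Longrightarrow> j \<in> L' \<Longrightarrow> i + j \<in> L''"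
  shows "f * g \<in> gsum G L''"
  using assms(1)
proof (induction rule: gsum.induct)
  case (add i x f)
  have "x * g \<in> gsum G L''"
    using assms(2)
  proof (induction rule: gsum.induct)
    case (add j y g)
    then show ?case
      using gsum.add[of "i + j" L'' "x * y" G "x * g"] sub[OF \<open>i \<in> L\<close> \<open>j \<in> L'\<close>]
        G_mult[OF \<open>x \<in> G i\<close> \<open>y \<in> G j\<close>]
      by (simp add: distrib_left)
  qed (simp add: gsum.zero)
  then show ?case using add.IH by (simp add: distrib_right gsum_add)
qed (simp add: gsum.zero)

text \<open>Summands of equal grade are merged, because \<open>G_indep\<close> speaks of families
  with one member for each grade.\<close>

lemma gsum_obtain:
  assumes "f \<in> gsum G L"
  obtains S h where "finite S" "S \<subseteq> L" "\<And>i. i \<in> S \<Longrightarrow> h i \<in> G i" "f = sum h S"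
proof -
  have "\<exists>S h. finite S \<and> S \<subseteq> L \<and> (\<forall>i\<in>S. h i \<in> G i) \<and> f = sum h S"
    using assms
  proof (induction rule: gsum.induct)
    case zero
    show ?case by (rule exI[of _ "{}"]) simp
  next
    case (add i x f)
    then obtain S h where S: "finite S" "S \<subseteq> L" "\<forall>i\<in>S. h i \<in> G i" "f = sum h S" by blast
    let ?h = "h(i := if i \<in> S then x + h i else x)"
    have "sum ?h (insert i S) = x + sum h S"
    proof (cases "i \<in> S")
      case True
      have "sum ?h S = sum (\<lambda>j. (if j = i then x else 0) + h j) S"
        using True by (intro sum.cong) auto
      then show ?thesis using True S(1) by (simp add: insert_absorb sum.distrib)
    next
      case False
      have "sum ?h S = sum h S" using False by (intro sum.cong) auto
      then show ?thesis using False S(1) by simp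
    qed
    then show ?case
      using add S by (intro exI[of _ "insert i S"] exI[of _ ?h]) (auto intro: G_add)
  qed
  then show ?thesis using that by blast
qed

text \<open>Adding \<open>- f\<close> in grade \<open>j\<close> to the summands of \<open>f\<close>
  with grades in \<open>L\<close> gives a relation to which independence applies.\<close>

lemma gsum_disjoint:
  assumes "f \<in> gsum G L" "f \<in> G j" "j \<notin> L"
  shows "\<Omega> dvd f"
proof -
  obtain S h where S: "finite S" "S \<subseteq> L" "\<And>i. i \<in> S \<Longrightarrow> h i \<in> G i" "f = sum h S"
    using gsum_obtain[OF assms(1)] by blast
  have "j \<notin> S" using S(2) assms(3) by blast
  let ?h = "h(j := - f)"
  have "sum ?h S = sum h S" using \<open>j \<notin> S\<close> by (intro sum.cong) auto
  then have "sum ?h (insert j S) = 0" using S(1,4) \<open>j \<notin> S\<close> by simp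
  then have "\<Omega> dvd ?h j"
    using S(1,3) assms(2) G_uminus by (intro G_indep[of "insert j S" ?h j]) auto
  then show ?thesis by simp
qed

lemma polys_nonpos: "f \<in> polys (n + 1) \<Longrightarrow> f \<in> gsum G {..0}"
proof (drule G_span, induction rule: gsum.induct)
  case (add i x f)
  have "x \<in> gsum G {..0}"
  proof (cases "i \<le> 0")
    case False
    then have "\<Omega> dvd x" using G_pos[of i x] add by simp
    moreover have "x \<in> polys (n + 1)" using G_polys add by blast
    ultimately show ?thesis using gsum_ideal[of x 0] by simp
  qed (use add gsum_component in auto)
  then show ?case using add gsum_add by blast
qed (simp add: gsum.zero)

text \<open>Splits off the component \<open>y\<close> of lowest grade, the leading form with respect
  to deg_G.\<close>

lemma gsum_split:
  "f \<in> gsum G {i..} \<Longrightarrow> \<exists>y\<in>G i. f - y \<in> gsum G {i + 1..}"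
proof (induction rule: gsum.induct)
  case zero
  show ?case using gsum.zero by (intro bexI[of _ 0]) auto
next
  case (add j x f)
  then obtain y where y: "y \<in> G i" "f - y \<in> gsum G {i + 1..}" by blast
  show ?case
  proof (cases "j = i")
    case True
    have "x + f - (x + y) \<in> gsum G {i + 1..}" using y(2) by simp
    then show ?thesis using True add y G_add by blast
  next
    case False
    then have "x + (f - y) \<in> gsum G {i + 1..}" using add y by (intro gsum.add[of j]) auto
    then have "x + f - y \<in> gsum G {i + 1..}" by (simp add: add_diff_eq)
    then show ?thesis using y(1) by blast
  qed
qed

lemma gsum_nonneg: "f \<in> gsum G {0..} \<Longrightarrow> \<exists>a. \<Omega> dvd f - const a"
proof (induction rule: gsum.induct)
  case zero
  show ?case by (rule exI[of _ 0]) simp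
next
  case (add i x f)
  then obtain a where a: "\<Omega> dvd f - const a" by blast
  have "\<exists>b. \<Omega> dvd x - const b"
  proof (cases "i = 0")
    case False
    then show ?thesis using G_pos[of i x] add by (intro exI[of _ 0]) simp
  qed (use add G_zero in simp)
  then obtain b where "\<Omega> dvd x - const b" by blast
  with a have "\<Omega> dvd (x - const b) + (f - const a)" by (intro dvd_add)
  then have "\<Omega> dvd x + f - const (b + a)" by (simp add: const_add algebra_simps)
  then show ?case by blast
qed

text \<open>\<open>M k\<close> contains the grade of y^k, and \<open>M' k\<close> the grades of f^k
  - y^k. The lemma serves for a component \<open>y\<close> of lowest grade and for a constant
  \<open>y\<close>, which has the highest grade 0.\<close>

lemma gsum_power_diff:
  assumes f: "f \<in> gsum G L" and y: "y \<in> G i" and diff: "f - y \<in> gsum G L'"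
    and M0: "\<And>k. int k * i \<in> M k" and M: "\<And>k a b. a \<in> L \<Longrightarrow> b \<in> M' k \<Longrightarrow> a + b \<in> M' (Suc k)"
    and M': "\<And>k a b. a \<in> L' \<Longrightarrow> b \<in> M k \<Longrightarrow> a + b \<in> M' (Suc k)"
  shows "f ^ k - y ^ k \<in> gsum G (M' k)"
proof (induction k)
  case 0
  then show ?case by (simp add: gsum.zero)
next
  case (Suc k)
  have "f * (f ^ k - y ^ k) \<in> gsum G (M' (Suc k))"
    using f Suc.IH M by (rule gsum_mult)
  moreover have "(f - y) * y ^ k \<in> gsum G (M' (Suc k))"
    using diff gsum_component[OF M0 G_power[OF y]] M' by (rule gsum_mult)
  moreover have "f ^ Suc k - y ^ Suc k = f * (f ^ k - y ^ k) + (f - y) * y ^ k"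
    by (simp add: algebra_simps)
  ultimately show ?case using gsum_add by metis
qed

section \<open>Degree estimates for the variables\<close>

lemma br_gsum:
  assumes "length us = n" "\<And>s. s < n \<Longrightarrow> us ! s \<in> gsum G {- a..}"
  shows "br n \<Omega> us \<in> gsum G {- (int n * a + int d\<^sub>0)..}"
proof -
  \<comment> \<open>The arguments below \<open>k\<close> are sums, and the others are single
    components. Additivity splits one argument at a time; for k = 0 the grades add up to at least -
    n a, and the bracket lowers the grade by d_0.\<close>
  have "br n \<Omega> us \<in> gsum G {- (int n * a + int d\<^sub>0)..}"
    if "k \<le> n" "length us = n" "\<And>s. s < k \<Longrightarrow> us ! s \<in> gsum G {- a..}"
      "\<And>s. k \<le> s \<Longrightarrow> s < n \<Longrightarrow> \<exists>i\<ge>- a. us ! s \<in> G i" for k us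
    using that
  proof (induction k arbitrary: us)
    case 0
    then obtain i where i: "\<And>s. s < n \<Longrightarrow> i s \<ge> - a \<and> us ! s \<in> G (i s)"
      by (metis le0)
    have "br n \<Omega> us \<in> G (sum_list (map i [0..<n]) - int d\<^sub>0)"
      using 0 i by (intro G_br) auto
    moreover have "(\<Sum>s<n. - a) \<le> (\<Sum>s<n. i s)"
      using i by (intro sum_mono) auto
    then have "- (int n * a) \<le> sum_list (map i [0..<n])"
      by (simp add: sum_list_distinct_conv_sum_set atLeast0LessThan)
    ultimately show ?case by (intro gsum_component) auto
  next
    case (Suc k)
    have "br n \<Omega> (us[k := x]) \<in> gsum G {- (int n * a + int d\<^sub>0)..}" if "x \<in> gsum G {- a..}" for x
      using that
    proof (induction rule: gsum.induct)
      case zero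
      then show ?case using br_const[of us n k \<Omega> 0] Suc.prems gsum.zero by simp
    next
      case (add i x f)
      have "br n \<Omega> (us[k := x]) \<in> gsum G {- (int n * a + int d\<^sub>0)..}"
      proof (rule Suc.IH)
        fix s assume s: "k \<le> s" "s < n"
        show "\<exists>i\<ge>- a. us[k := x] ! s \<in> G i"
          using Suc.prems(2) Suc.prems(4)[of s] s add.hyps by (cases "s = k") auto
      qed (use Suc.prems in \<open>auto simp: nth_list_update\<close>)
      then show ?case
        using add br_add[of us n k \<Omega> x f] Suc.prems gsum_add by simp
    qed
    from this[of "us ! k"] show ?case using Suc.prems by simp
  qed
  from this[of n us] show ?thesis using assms by simp
qed

lemma homogeneous_gsum:
  assumes "\<And>i. i < n + 1 \<Longrightarrow> var i \<in> gsum G {- a..}" and "homogeneous d p" "p \<in> polys (n + 1)"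
  shows "p \<in> gsum G {- (int d * a)..}"
  using assms(2,3)
proof (induction rule: homogeneous_induct)
  case (const x)
  show ?case using G_const gsum_component[of 0] by simp
next
  case (var d i p)
  show ?case using assms(1)[OF var(1)] var(2)
    by (rule gsum_mult) (auto simp: algebra_simps)
qed (auto intro: gsum.zero gsum_add)

lemma variables_descend:
  assumes a: "2 \<le> a" and vars: "\<And>i. i < n + 1 \<Longrightarrow> var i \<in> gsum G {- a..}" and i: "i < n + 1"
  shows "var i \<in> gsum G {- a + 1..}"
proof -
  have part: "partial j \<Omega> \<in> gsum G {- (int n * a + int d\<^sub>0)..}" if "j < n + 1" for j
  proof -
    let ?us = "map (\<lambda>s. var (if s = j then n else s) - const 0) [0..<n] :: 'a mpoly list"
    have "br n \<Omega> ?us \<in> gsum G {- (int n * a + int d\<^sub>0)..}"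
      using vars that by (intro br_gsum) auto
    moreover have "br n \<Omega> ?us \<in> {partial j \<Omega>, - partial j \<Omega>}"
      using br_variables[of j n \<Omega> "\<lambda>_. 0"] that by simp
    ultimately show ?thesis
      using gsum_uminus by fastforce
  qed
  have "1 \<le> int d\<^sub>0 * (a - 1)"
    using mult_mono[of 1 "int d\<^sub>0" 1 "a - 1"] a d\<^sub>0_pos by simp
  moreover have "int (K - (n + d\<^sub>0)) * a + (int n * a + int d\<^sub>0) = int K * a - int d\<^sub>0 * (a - 1)"
    using K_ge by (simp add: of_nat_diff algebra_simps)
  ultimately have bound: "int (K - (n + d\<^sub>0)) * a + (int n * a + int d\<^sub>0) \<le> int K * a - 1"
    by linarith
  have pow: "var i ^ K \<in> gsum G {- (int K * a) + 1..}"
    unfolding jac[OF i]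
  proof (rule gsum_sum)
    fix j assume "j \<in> {..<n + 1}"
    then show "c i j * partial j \<Omega> \<in> gsum G {- (int K * a) + 1..}"
      using homogeneous_gsum[OF vars c_hom c_polys] part[of j] bound
      by (intro gsum_mult[of "c i j" "{- (int (K - (n + d\<^sub>0)) * a)..}" "partial j \<Omega>"
            "{- (int n * a + int d\<^sub>0)..}"]) auto
  qed
  \<comment> \<open>y^K is the part of t_i^K in grade - K a, and \<open>pow\<close> leaves no room
    for such a part modulo \<Omega>.\<close>
  obtain y where y: "y \<in> G (- a)" "var i - y \<in> gsum G {- a + 1..}"
    using gsum_split[OF vars[OF i]] by blast
  have "var i ^ K - y ^ K \<in> gsum G {- (int K * a) + 1..}"
    using vars[OF i] y by (rule gsum_power_diff[where M = "\<lambda>k. {- (int k * a)..}"]) (auto simp: algebra_simps)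
  then have "y ^ K \<in> gsum G {- (int K * a) + 1..}"
    using gsum_diff[OF pow] by fastforce
  moreover have "y ^ K \<in> G (- (int K * a))"
    using G_power[OF y(1), of K] by simp
  ultimately have "\<Omega> dvd y ^ K"
    by (rule gsum_disjoint) simp
  then have "\<Omega> dvd y"
    using hypersurface_reduced[OF \<Omega>_nonzero \<Omega>_hom \<Omega>_polys _ jac, of y K] n_pos y(1) G_polys by auto
  then have "y \<in> gsum G {- a + 1..}"
    using y(1) G_polys by (intro gsum_ideal[of y "- a + 1"]) auto
  from gsum_add[OF this y(2)] show ?thesis by simp
qed

text \<open>Starting point of the descent. The bound has the form 1 + k so that the induction on
  \<open>k\<close> stops at a = 1, where \<open>variables_descend\<close> ceases to apply.\<close>

lemma variables_bounded:
  "\<exists>k. \<forall>i<m. i < n + 1 \<longrightarrow> var i \<in> gsum G {- (1 + int k)..}"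
proof (induction m)
  case (Suc m)
  then obtain k where k: "\<forall>i<m. i < n + 1 \<longrightarrow> var i \<in> gsum G {- (1 + int k)..}" by blast
  have "\<exists>l. f \<in> gsum G {- (1 + int l)..}" if "f \<in> gsum G UNIV" for f
    using that
  proof (induction rule: gsum.induct)
    case (add i x f)
    then obtain l where l: "f \<in> gsum G {- (1 + int l)..}" by blast
    let ?l = "max l (nat (- i))"
    have "f \<in> gsum G {- (1 + int ?l)..}" using l by (rule gsum_mono) auto
    then have "x + f \<in> gsum G {- (1 + int ?l)..}" using add by (intro gsum.add[of i]) auto
    then show ?case by blast
  qed (auto intro: gsum.zero)
  then obtain l where l: "m < n + 1 \<Longrightarrow> var m \<in> gsum G {- (1 + int l)..}"
    using G_span[OF polys_var] by blast
  have "\<forall>i<Suc m. i < n + 1 \<longrightarrow> var i \<in> gsum G {- (1 + int (max k l))..}"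
  proof (intro allI impI)
    fix i assume i: "i < Suc m" "i < n + 1"
    show "var i \<in> gsum G {- (1 + int (max k l))..}"
    proof (cases "i = m")
      case True
      then show ?thesis using l i by (auto elim: gsum_mono)
    next
      case False
      then have "var i \<in> gsum G {- (1 + int k)..}" using k i by simp
      then show ?thesis by (rule gsum_mono) auto
    qed
  qed
  then show ?case by blast
qed simp

lemma variables_ge_minus_one:
  assumes "i < n + 1"
  shows "var i \<in> gsum G {- 1..}"
proof -
  have "\<forall>i<n + 1. var i \<in> gsum G {- 1..}"
    if "\<forall>i<n + 1. var i \<in> gsum G {- (1 + int k)..}" for k
    using that
  proof (induction k)
    case (Suc k)
    then show ?case
      using variables_descend[of "1 + int (Suc k)"] by (auto simp: algebra_simps)
  qed simp
  moreover obtain k where "\<forall>i<n + 1. i < n + 1 \<longrightarrow> var i \<in> gsum G {- (1 + int k)..}"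
    using variables_bounded[of "n + 1"] by blast
  ultimately show ?thesis using assms by blast
qed

lemma not_\<Omega>_dvd_const: "a \<noteq> 0 \<Longrightarrow> \<not> \<Omega> dvd const a"
proof
  assume a: "a \<noteq> 0" and "\<Omega> dvd const a"
  then obtain r where "const a = r * \<Omega>" by (metis dvd_def mult.commute)
  then have "hcomp 0 (const a) = 0"
    using hcomp_mult_homogeneous_less[OF \<Omega>_hom, of 0 r] by simp
  then have "const a = 0" using hcomp_homogeneous[OF homogeneous_const, of 0 a] by simp
  then show False using a by (metis const_def lookup_single_eq lookup_zero)
qed

lemma variables_component:
  assumes i: "i < n + 1"
  shows "var i \<in> G (- 1)"
proof -
  have "\<exists>a. var i - const a \<in> G (- 1)" if i: "i < n + 1" for i
  proof -
    obtain y where y: "y \<in> G (- 1)" "var i - y \<in> gsum G {0..}"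
      using gsum_split[OF variables_ge_minus_one[OF i]] by auto
    then obtain a where a: "\<Omega> dvd var i - y - const a"
      using gsum_nonneg by blast
    have "var i - y - const a \<in> polys (n + 1)"
      using y G_polys i by (intro polys_diff polys_var polys_const) auto
    \<comment> \<open>The remainder is a multiple of \<Omega> and is absorbed, since every
      \<open>G i\<close> contains the ideal.\<close>
    then have "y + (var i - y - const a) \<in> G (- 1)"
      using y(1) a by (intro G_add G_ideal[of "var i - y - const a"])
    then show ?thesis by (auto simp: algebra_simps)
  qed
  then obtain a where a: "\<And>i. i < n + 1 \<Longrightarrow> var i - const (a i) \<in> G (- 1)" by metis
  have part: "partial j \<Omega> \<in> gsum G {..<0}" if "j < n + 1" for j
  proof -
    let ?\<sigma> = "\<lambda>s. if s = j then n else s"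
    let ?us = "map (\<lambda>s. var (?\<sigma> s) - const (a (?\<sigma> s))) [0..<n]"
    have "br n \<Omega> ?us \<in> G (sum_list (replicate n (- 1)) - int d\<^sub>0)"
      using a that by (intro G_br) auto
    then have "br n \<Omega> ?us \<in> gsum G {..<0}"
      using n_pos by (intro gsum_component) (auto simp: sum_list_replicate)
    moreover have "br n \<Omega> ?us \<in> {partial j \<Omega>, - partial j \<Omega>}"
      using br_variables[of j n \<Omega> a] that by simp
    ultimately show ?thesis
      using gsum_uminus by fastforce
  qed
  have pow: "var i ^ K \<in> gsum G {..<0}"
    unfolding jac[OF i]
    using part polys_nonpos[OF c_polys] by (intro gsum_sum gsum_mult[of _ "{..0}" _ "{..<0}"]) auto
  \<comment> \<open>Here the constant is the part of highest grade: t_i - a_i has grade - 1, so that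
    t_i^K and a_i^K agree up to negative grades.\<close>
  have "var i ^ K - const (a i) ^ K \<in> gsum G {..<0}"
    using polys_nonpos[OF polys_var[OF i]] G_const gsum_component[OF _ a[OF i], of "{..<0}"]
    by (rule gsum_power_diff[where M = "\<lambda>_. {..0}"]) auto
  then have "const (a i ^ K) \<in> gsum G {..<0}"
    using gsum_diff[OF pow] by (fastforce simp: const_power)
  then have "\<Omega> dvd const (a i ^ K)"
    using G_const by (rule gsum_disjoint) simp
  then have "a i = 0"
    using not_\<Omega>_dvd_const[of "a i ^ K"] by auto
  then show ?thesis using a[OF i] by simp
qed

lemma homogeneous_component:
  assumes "homogeneous d p" "p \<in> polys (n + 1)"
  shows "p \<in> G (- int d)"
  using assms
proof (induction rule: homogeneous_induct)
  case (const x)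
  show ?case using G_const by simp
next
  case (var d i p)
  show ?case using G_mult[OF variables_component[OF var(1)] var(2)] by simp
qed (auto intro: G_add)

lemma std_component: "std (n + 1) i \<subseteq> G i"
proof
  fix p :: "'a mpoly" assume p: "p \<in> std (n + 1) i"
  show "p \<in> G i"
  proof (cases "i \<le> 0")
    case True
    then have "homogeneous (nat (- i)) p" using p by (auto simp: homogeneous_iff std_def)
    then show ?thesis using homogeneous_component[of "nat (- i)" p] p True by (simp add: std_def)
  next
    case False
    then have "Poly_Mapping.keys p = {}" using p by (fastforce simp: std_def)
    then show ?thesis by simp
  qed
qed

text \<open>A grading that contains another one component by component coincides with it: the degree
  decomposition of \<open>f\<close> is also a decomposition with respect to \<open>G\<close>, and
  these are unique modulo \<Omega>.\<close>

theorem G_eq: "G i = {f \<in> polys (n + 1). \<exists>p\<in>std (n + 1) i. \<Omega> dvd f - p}"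
proof (intro Set.set_eqI iffI)
  fix f assume "f \<in> {f \<in> polys (n + 1). \<exists>p\<in>std (n + 1) i. \<Omega> dvd f - p}"
  then obtain p where f: "f \<in> polys (n + 1)" "\<Omega> dvd f - p" and p: "p \<in> std (n + 1) i" by blast
  have "p \<in> polys (n + 1)" using p by (simp add: std_def)
  with f have "f - p \<in> G i" by (intro G_ideal polys_diff)
  then have "p + (f - p) \<in> G i"
    using p std_component by (intro G_add) auto
  then show "f \<in> G i" by simp
next
  fix f assume f: "f \<in> G i"
  then have fp: "f \<in> polys (n + 1)" using G_polys by blast
  obtain b where b: "\<forall>m\<in>Poly_Mapping.keys f. mdeg m < b" using mdeg_bound by blast
  define T where "T = (\<lambda>d. - int d) ` {..<b}"
  define g where "g j = (if j \<in> T then hcomp (nat (- j)) f else 0)" for j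
  have g: "g j \<in> std (n + 1) j" for j
    using homogeneous_hcomp[of "nat (- j)" f] polys_hcomp[OF fp, of "nat (- j)"]
    by (auto simp: g_def T_def std_def homogeneous_iff)
  let ?h = "\<lambda>j. g j - (if j = i then f else 0)"
  \<comment> \<open>The grade \<open>i\<close> may lie outside \<open>T\<close>, for instance if it
    is positive.\<close>
  have "sum g (insert i T) = sum g T"
    by (intro sum.mono_neutral_right) (auto simp: T_def g_def)
  also have "\<dots> = (\<Sum>d<b. hcomp d f)"
    unfolding T_def by (subst sum.reindex) (auto simp: inj_on_def g_def T_def)
  also have "\<dots> = f" using b by (intro sum_hcomp) auto
  finally have "sum ?h (insert i T) = 0"
    unfolding sum_subtractf by (simp add: T_def)
  then have "\<Omega> dvd ?h i"
  proof (intro G_indep[of "insert i T" ?h i])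
    fix j
    have "g j \<in> G j" using g std_component by blast
    then show "?h j \<in> G j" using G_add[of "g j" j "- f"] G_uminus f by auto
  qed (auto simp: T_def)
  then have "\<Omega> dvd f - g i"
    using dvd_minus_iff[of \<Omega> "g i - f"] by simp
  then show "f \<in> {f \<in> polys (n + 1). \<exists>p\<in>std (n + 1) i. \<Omega> dvd f - p}"
    using fp g by blast
qed

end

text \<open>This keeps the number of variables in the form \<open>n + 1\<close>.\<close>

declare One_nat_def [simp del]

section \<open>Quotients of polynomial algebras\<close>

definition cls :: "'a::comm_ring_1 mpoly set \<Rightarrow> 'a mpoly \<Rightarrow> 'a mpoly set" where
  "cls I x = (\<lambda>a. a + x) ` I"

locale poly_ideal =
  fixes N :: nat and I :: "'a::field mpoly set"
  assumes I_polys: "I \<subseteq> polys N" and I_zero: "0 \<in> I"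
    and I_add: "\<And>a b. a \<in> I \<Longrightarrow> b \<in> I \<Longrightarrow> a + b \<in> I"
    and I_mult: "\<And>a r. a \<in> I \<Longrightarrow> r \<in> polys N \<Longrightarrow> r * a \<in> I"
begin

lemma I_uminus: "a \<in> I \<Longrightarrow> - a \<in> I"
  using I_mult[of a "- 1"] by simp

lemma I_diff: "a \<in> I \<Longrightarrow> b \<in> I \<Longrightarrow> a - b \<in> I"
  using I_add[of a "- b"] I_uminus by simp

lemma I_sum: "(\<And>x. x \<in> A \<Longrightarrow> f x \<in> I) \<Longrightarrow> sum f A \<in> I"
  by (induction A rule: infinite_finite_induct) (auto intro: I_add I_zero)

lemma cls_self: "x \<in> cls I x"
  using I_zero by (force simp: cls_def)

lemma mem_cls: "y \<in> cls I x \<longleftrightarrow> y - x \<in> I"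
  by (force simp: cls_def image_iff algebra_simps)

lemma cls_eq_iff: "cls I x = cls I y \<longleftrightarrow> x - y \<in> I"
proof
  assume "cls I x = cls I y"
  then show "x - y \<in> I" using cls_self[of x] by (simp add: mem_cls)
next
  assume xy: "x - y \<in> I"
  show "cls I x = cls I y"
  proof (intro Set.set_eqI)
    fix z
    have "z - y = (z - x) + (x - y)" "z - x = (z - y) - (x - y)" by simp_all
    then show "z \<in> cls I x \<longleftrightarrow> z \<in> cls I y"
      unfolding mem_cls using I_add[of "z - x" "x - y"] I_diff[of "z - y" "x - y"] xy by metis
  qed
qed

lemma cls_polys: "x \<in> polys N \<Longrightarrow> y \<in> cls I x \<Longrightarrow> y \<in> polys N"
  using I_polys polys_add[of "y - x" N x] by (auto simp: mem_cls)

lemma cls_eq_zero: "cls I x = cls I 0 \<longleftrightarrow> x \<in> I"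
  by (simp add: cls_eq_iff)

end

text \<open>A common interface to the quotient by the Jacobian ideal, which is used as a vector
  space, and to \<open>P_Omega\<close>, which also has a bracket. All operations are described on
  representatives.\<close>

locale quotient_poly_alg = poly_ideal N I
  for N :: nat and I :: "'a::field mpoly set" +
  fixes Q :: "('a, 'a mpoly set, 'q) module_scheme" (structure)
  assumes carrier_Q: "carrier Q = cls I ` polys N"
    and add_Q: "\<And>x y. x \<in> polys N \<Longrightarrow> y \<in> polys N \<Longrightarrow> cls I x \<oplus> cls I y = cls I (x + y)"
    and mult_Q: "\<And>x y. x \<in> polys N \<Longrightarrow> y \<in> polys N \<Longrightarrow> cls I x \<otimes> cls I y = cls I (x * y)"
    and zero_Q: "\<zero> = cls I 0" and one_Q: "\<one> = cls I 1"
    and smult_Q: "\<And>a x. x \<in> polys N \<Longrightarrow> a \<odot> cls I x = cls I (const a * x)"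
begin

lemma cls_carrier: "x \<in> polys N \<Longrightarrow> cls I x \<in> carrier Q"
  by (simp add: carrier_Q)

lemma abelian_group_Q: "abelian_group Q"
proof (rule abelian_groupI)
  fix x assume "x \<in> carrier Q"
  then obtain p where p: "p \<in> polys N" "x = cls I p" by (auto simp: carrier_Q)
  then show "\<exists>y\<in>carrier Q. y \<oplus> x = \<zero>"
    by (intro bexI[of _ "cls I (- p)"]) (auto simp: add_Q zero_Q carrier_Q)
qed (auto simp: carrier_Q add_Q zero_Q polys_add add_ac)

lemma cring_Q: "cring Q"
proof (rule cringI)
  show "comm_monoid Q"
    by (rule comm_monoidI) (auto simp: carrier_Q mult_Q one_Q polys_mult mult_ac)
qed (auto simp: abelian_group_Q carrier_Q mult_Q add_Q polys_mult polys_add distrib_right)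

lemma algebra_Q: "algebra class_ring Q"
proof (rule algebraI)
  show "cring (class_ring :: 'a ring)"
    using class_field by (intro domain.axioms(1) field.axioms(1))
qed (auto simp: cring_Q carrier_Q smult_Q add_Q mult_Q polys_mult polys_add distrib_left distrib_right
    const_add const_mult mult.assoc)

lemma vectorspace_Q: "vectorspace class_ring Q"
  using algebra_Q class_field by (intro vectorspace.intro algebra.axioms(1))

lemma finsum_Q:
  assumes "finite S" "\<And>i. i \<in> S \<Longrightarrow> f i \<in> polys N" "\<And>i. i \<in> S \<Longrightarrow> F i = cls I (f i)"
  shows "(\<Oplus>i\<in>S. F i) = cls I (sum f S)"
proof -
  interpret abelian_group Q by (rule abelian_group_Q)
  show ?thesis using assms
  proof (induction S rule: finite_induct)
    case (insert i S)
    have "F \<in> S \<rightarrow> carrier Q" "F i \<in> carrier Q"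
      using insert.prems by (auto simp: carrier_Q)
    then show ?case
      using insert by (simp add: add_Q polys_sum)
  qed (simp add: zero_Q)
qed

text \<open>A representative \<open>p i\<close> may be nonzero although its class vanishes; such
  terms lie in \<open>I\<close>, so that the sum over the support can be taken over any larger
  finite set.\<close>

lemma finsum_support:
  assumes "finite U" "{i. F i \<noteq> \<zero>} \<subseteq> U"
    and p: "\<And>i. p i \<in> polys N" and F: "\<And>i. F i = cls I (p i)"
  shows "(\<Oplus>i\<in>{i. F i \<noteq> \<zero>}. F i) = cls I (sum p U)"
proof -
  let ?S = "{i. F i \<noteq> \<zero>}"
  have "(\<Oplus>i\<in>?S. F i) = cls I (sum p ?S)"
    using finite_subset[OF assms(2,1)] p F by (intro finsum_Q) auto
  also have "\<dots> = cls I (sum p U)"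
  proof -
    have "sum p (U - ?S) \<in> I"
      by (intro I_sum) (auto simp: zero_Q F cls_eq_zero)
    moreover have "sum p U = sum p ?S + sum p (U - ?S)"
      using sum.subset_diff[OF assms(2,1), of p] by (simp only: add.commute)
    ultimately have "sum p U - sum p ?S \<in> I" by simp
    then have "cls I (sum p U) = cls I (sum p ?S)" by (simp only: cls_eq_iff)
    then show ?thesis by simp
  qed
  finally show ?thesis .
qed

end

text \<open>Covers both \<open>poly_alg\<close> and \<open>A_Omega\<close>, which share the ring
  operations but are different record types.\<close>

locale poly_record =
  fixes N :: nat and M :: "('a::field, 'a mpoly, 'm) module_scheme" (structure)
  assumes carrier_M: "carrier M = polys N" and mult_M: "mult M = (*)" and one_M: "one M = 1"
    and zero_M: "zero M = 0" and add_M: "add M = (+)" and smult_M: "smult M = (\<lambda>c p. const c * p)"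
begin

lemma cring_M: "cring M"
proof (rule cringI)
  show "abelian_group M"
  proof (rule abelian_groupI)
    fix x assume "x \<in> carrier M"
    then show "\<exists>y\<in>carrier M. y \<oplus> x = \<zero>"
      by (intro bexI[of _ "- x"]) (simp_all add: carrier_M add_M zero_M)
  qed (simp_all add: carrier_M add_M zero_M polys_add add_ac)
  show "comm_monoid M"
    by (rule comm_monoidI) (simp_all add: carrier_M mult_M one_M polys_mult mult_ac)
qed (simp_all add: carrier_M mult_M add_M distrib_right)

lemma poly_ideal_if_ideal:
  assumes "ideal I M"
  shows "poly_ideal N I"
proof -
  interpret ideal I M by fact
  have "I \<subseteq> polys N" using a_subset by (simp add: carrier_M)
  moreover have "0 \<in> I"
    using additive_subgroup.zero_closed[OF is_additive_subgroup] by (simp add: zero_M)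
  moreover have "a + b \<in> I" if "a \<in> I" "b \<in> I" for a b
    using additive_subgroup.a_closed[OF is_additive_subgroup that] by (simp add: add_M)
  moreover have "r * a \<in> I" if "a \<in> I" "r \<in> polys N" for a r
    using I_l_closed[of a r] that by (simp add: carrier_M mult_M)
  ultimately show ?thesis by (rule poly_ideal.intro)
qed

lemma genideal_subset:
  fixes k :: nat
  assumes g: "\<And>j. j < k \<Longrightarrow> g j \<in> polys N"
  shows "Idl (g ` {..<k}) \<subseteq> {\<Sum>j<k. r j * g j | r. \<forall>j. r j \<in> polys N}" (is "_ \<subseteq> ?T")
proof -
  interpret cring M by (rule cring_M)
  have "ideal ?T M"
  proof (rule idealI)
    show "ring M" by (rule ring_axioms)
    show "subgroup ?T (add_monoid M)"
    proof (rule group.subgroupI)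
      show "group (add_monoid M)" by (rule a_group)
      show "?T \<subseteq> carrier (add_monoid M)"
        using g by (auto simp: carrier_M intro!: polys_sum polys_mult)
      show "?T \<noteq> {}" by (auto intro: exI[of _ "\<lambda>_. 0"])
    next
      fix a assume "a \<in> ?T"
      then obtain r where r: "a = (\<Sum>j<k. r j * g j)" "\<forall>j. r j \<in> polys N" by blast
      have a: "a \<in> carrier M" using g r by (auto simp: carrier_M intro!: polys_sum polys_mult)
      then have "\<ominus> a \<oplus> a = \<zero>" by (rule l_neg)
      then have "\<ominus> a = - a" by (simp add: add_M zero_M eq_neg_iff_add_eq_0)
      also have "\<dots> = (\<Sum>j<k. (- r j) * g j)" by (simp add: r(1) sum_negf)
      finally have "\<ominus> a \<in> ?T" using r(2) by (intro CollectI exI[of _ "\<lambda>j. - r j"]) auto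
      then show "inv\<^bsub>add_monoid M\<^esub> a \<in> ?T" by (simp add: a_inv_def)
    next
      fix a b assume "a \<in> ?T" "b \<in> ?T"
      then obtain r s where "a = (\<Sum>j<k. r j * g j)" "\<forall>j. r j \<in> polys N"
        "b = (\<Sum>j<k. s j * g j)" "\<forall>j. s j \<in> polys N" by blast
      then have "a + b = (\<Sum>j<k. (r j + s j) * g j)" "\<forall>j. r j + s j \<in> polys N"
        by (simp_all add: distrib_right sum.distrib polys_add)
      then show "a \<otimes>\<^bsub>add_monoid M\<^esub> b \<in> ?T"
        by (intro CollectI exI[of _ "\<lambda>j. r j + s j"]) (simp add: add_M)
    qed
    fix a x assume "a \<in> ?T" and x: "x \<in> carrier M"
    then obtain r where "a = (\<Sum>j<k. r j * g j)" "\<forall>j. r j \<in> polys N" by blast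
    then have "x * a = (\<Sum>j<k. (x * r j) * g j)" "\<forall>j. x * r j \<in> polys N"
      using x by (simp_all add: sum_distrib_left mult.assoc polys_mult carrier_M)
    then have "x * a \<in> ?T"
      by (intro CollectI exI[of _ "\<lambda>j. x * r j"]) simp
    then show "x \<otimes> a \<in> ?T" "a \<otimes> x \<in> ?T"
      by (simp_all add: mult_M mult.commute)
  qed
  moreover have "g ` {..<k} \<subseteq> ?T"
  proof
    fix a assume "a \<in> g ` {..<k}"
    then obtain i where i: "i < k" "a = g i" by auto
    have "(\<Sum>j<k. (if j = i then 1 else 0) * g j) = (\<Sum>j<k. if j = i then g j else 0)"
      by (intro sum.cong) auto
    then have "a = (\<Sum>j<k. (if j = i then 1 else 0) * g j)"
      using i by (simp add: sum.delta)
    then show "a \<in> ?T" by (intro CollectI exI[of _ "\<lambda>j. if j = i then 1 else 0"]) auto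
  qed
  ultimately show ?thesis by (rule genideal_minimal)
qed

lemma genideal_singleton:
  assumes "q \<in> polys N"
  shows "Idl {q} = {f \<in> polys N. q dvd f}"
proof
  interpret cring M by (rule cring_M)
  have "{q} = (\<lambda>_. q) ` {..<1::nat}" by auto
  then have "Idl {q} \<subseteq> {\<Sum>j<1::nat. r j * q | r. \<forall>j. r j \<in> polys N}"
    using genideal_subset[of 1 "\<lambda>_. q"] assms by metis
  also have "\<dots> \<subseteq> {f \<in> polys N. q dvd f}"
    using assms by (auto simp: One_nat_def intro: polys_mult)
  finally show "Idl {q} \<subseteq> {f \<in> polys N. q dvd f}" .
  have id: "ideal (Idl {q}) M" using assms by (intro genideal_ideal) (simp add: carrier_M)
  have q: "q \<in> Idl {q}" using assms by (intro genideal_self') (simp add: carrier_M)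
  show "{f \<in> polys N. q dvd f} \<subseteq> Idl {q}"
  proof
    fix f assume "f \<in> {f \<in> polys N. q dvd f}"
    then obtain r where "r \<in> polys N" "f = r * q"
      using dvd_polys[of q f N] assms by blast
    then show "f \<in> Idl {q}"
      using ideal.I_l_closed[OF id q, of r] by (simp add: carrier_M mult_M)
  qed
qed

lemma r_coset_eq_cls: "I +> x = cls I x"
  by (auto simp: a_r_coset_def r_coset_def cls_def add_M)

text \<open>The unions over representatives in the two multiplications collapse to a single coset,
  because the result does not change modulo \<open>I\<close>.\<close>

lemma quotient_fields:
  assumes "poly_ideal N I"
  shows "a_rcosets I = cls I ` polys N"
    and "x \<in> polys N \<Longrightarrow> y \<in> polys N \<Longrightarrow> set_add M (cls I x) (cls I y) = cls I (x + y)"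
    and "x \<in> polys N \<Longrightarrow> y \<in> polys N \<Longrightarrow> rcoset_mult M I (cls I x) (cls I y) = cls I (x * y)"
    and "x \<in> polys N \<Longrightarrow> (\<Union>x'\<in>cls I x. I +> (a \<odot> x')) = cls I (const a * x)"
    and "cls I 0 = I" and "I +> 1 = cls I 1"
proof -
  interpret poly_ideal N I by fact
  show "a_rcosets I = cls I ` polys N"
    unfolding A_RCOSETS_def RCOSETS_def
    using r_coset_eq_cls[of I] by (auto simp: a_r_coset_def carrier_M)
  show "cls I 0 = I" by (simp add: cls_def)
  show "I +> 1 = cls I 1" by (rule r_coset_eq_cls)
  show "set_add M (cls I x) (cls I y) = cls I (x + y)" if "x \<in> polys N" "y \<in> polys N"
  proof (intro Set.set_eqI iffI)
    fix z assume "z \<in> set_add M (cls I x) (cls I y)"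
    then obtain a b where "a \<in> cls I x" "b \<in> cls I y" "z = a + b"
      by (auto simp: set_add_def set_mult_def add_M)
    then show "z \<in> cls I (x + y)"
      using I_add[of "a - x" "b - y"] by (simp add: mem_cls algebra_simps)
  next
    fix z assume "z \<in> cls I (x + y)"
    then have "z - y \<in> cls I x" by (simp add: mem_cls algebra_simps)
    then have "\<exists>u\<in>cls I x. \<exists>v\<in>cls I y. z = u + v"
      using cls_self[of y] by (intro bexI[of _ "z - y"] bexI[of _ y]) auto
    then show "z \<in> set_add M (cls I x) (cls I y)"
      by (simp add: set_add_def set_mult_def add_M)
  qed
  show "rcoset_mult M I (cls I x) (cls I y) = cls I (x * y)" if xy: "x \<in> polys N" "y \<in> polys N"
  proof -
    have "cls I (a * b) = cls I (x * y)" if "a \<in> cls I x" "b \<in> cls I y" for a b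
    proof -
      have "a \<in> polys N" using cls_polys xy that by blast
      then have "a * (b - y) + y * (a - x) \<in> I"
        using that xy by (intro I_add I_mult) (simp_all add: mem_cls)
      then show ?thesis by (simp add: cls_eq_iff algebra_simps)
    qed
    then show ?thesis
      using cls_self[of x] cls_self[of y] unfolding rcoset_mult_def r_coset_eq_cls mult_M by blast
  qed
  show "(\<Union>x'\<in>cls I x. I +> (a \<odot> x')) = cls I (const a * x)" if "x \<in> polys N"
  proof -
    have "cls I (const a * x') = cls I (const a * x)" if "x' \<in> cls I x" for x'
      using I_mult[of "x' - x" "const a"] that by (simp add: cls_eq_iff mem_cls algebra_simps)
    then show ?thesis
      using cls_self[of x] unfolding r_coset_eq_cls smult_M by blast
  qed
qed

lemma quotient_quot_alg:
  assumes "poly_ideal N I"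
  shows "quotient_poly_alg N I (quot_alg M I)"
  using assms unfolding quotient_poly_alg_def quotient_poly_alg_axioms_def
  by (auto simp: quot_alg_def ring.extend_def module.fields_def FactRing_def
      quotient_fields[OF assms] one_M)

end

lemma poly_record_poly_alg: "poly_record N (poly_alg N)"
  by (simp add: poly_record_def polys_def poly_alg_def const_def)

lemma poly_record_A_Omega: "poly_record (n + 1) (A_Omega n \<Omega>)"
  by (simp add: poly_record_def A_Omega_def module.extend_def polys_def poly_alg_def const_def)

section \<open>The Jacobian ideal contains powers of the variables\<close>

text \<open>Modulo the Jacobian ideal, t_i^K is a combination of finitely many representatives, all
  of degree below K. In the component of degree K of this congruence they disappear, and what is
  left is an equation with homogeneous coefficients.\<close>

lemma potential_variable_powers:
  fixes \<Omega> :: "'a::field_char_0 mpoly"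
  assumes pot: "is_potential n \<Omega>" and hom: "homogeneous (n + 1 + d) \<Omega>"
  obtains K c where "n + d \<le> K"
    and "\<And>i. i < n + 1 \<Longrightarrow> var i ^ K = (\<Sum>j<n + 1. c i j * partial j \<Omega>)"
    and "\<And>i j. c i j \<in> polys (n + 1)" and "\<And>i j. homogeneous (K - (n + d)) (c i j)"
proof -
  let ?N = "n + 1" and ?M = "poly_alg (n + 1) :: ('a, 'a mpoly) module"
  interpret poly_record ?N ?M by (rule poly_record_poly_alg)
  interpret M: cring ?M by (rule cring_M)
  define J where "J = Idl\<^bsub>?M\<^esub> {partial i \<Omega> | i. i < n + 1}"
  have gens: "{partial i \<Omega> | i. i < n + 1} = (\<lambda>i. partial i \<Omega>) ` {..<?N}" by auto
  have \<Omega>: "\<Omega> \<in> polys ?N" using pot by (simp add: is_potential_def polys_def)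
  have "ideal J ?M"
    unfolding J_def gens using \<Omega> by (intro M.genideal_ideal) (auto simp: carrier_M intro: polys_partial)
  then have J: "poly_ideal ?N J" by (rule poly_ideal_if_ideal)
  let ?Q = "quot_alg ?M J"
  interpret Q: quotient_poly_alg ?N J ?Q using J by (rule quotient_quot_alg)
  interpret V: vectorspace class_ring ?Q by (rule Q.vectorspace_Q)
  have "V.fin_dim" using pot by (simp add: is_potential_def J_def)
  then obtain A where A: "finite A" "A \<subseteq> carrier ?Q" "V.span A = carrier ?Q"
    unfolding V.fin_dim_def by blast
  have "\<forall>X\<in>A. \<exists>p. p \<in> polys ?N \<and> X = cls J p" using A(2) by (auto simp: Q.carrier_Q)
  then obtain p where p: "\<And>X. X \<in> A \<Longrightarrow> p X \<in> polys ?N \<and> X = cls J (p X)" by metis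
  have "\<exists>b. \<forall>m\<in>Poly_Mapping.keys (p X). mdeg m < b" for X by (rule mdeg_bound)
  then obtain b where b: "\<And>X. \<forall>m\<in>Poly_Mapping.keys (p X). mdeg m < b X" by metis
  \<comment> \<open>K exceeds the degrees of all representatives and does not depend on the
    variable; including n + d keeps the subtraction in K - (n + d) from being truncated.\<close>
  define K where "K = Max (insert (n + d) (b ` A))"
  have K: "n + d \<le> K" "\<And>X. X \<in> A \<Longrightarrow> b X \<le> K" using A(1) by (auto simp: K_def)
  have "\<exists>c. (\<forall>j. c j \<in> polys ?N \<and> homogeneous (K - (n + d)) (c j)) \<and>
      var i ^ K = (\<Sum>j<?N. c j * partial j \<Omega>)" if i: "i < ?N" for i
  proof -
    have v: "var i ^ K \<in> polys ?N" using i by (intro polys_power polys_var)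
    have "cls J (var i ^ K) \<in> V.span A" unfolding A(3) by (rule Q.cls_carrier[OF v])
    then obtain a B where B: "finite B" "B \<subseteq> A" "cls J (var i ^ K) = V.lincomb a B"
      unfolding V.span_def by blast
    have "V.lincomb a B = cls J (\<Sum>X\<in>B. const (a X) * p X)"
      unfolding V.lincomb_def
    proof (rule Q.finsum_Q)
      fix X assume "X \<in> B"
      then have X: "p X \<in> polys ?N" "X = cls J (p X)" using p B by auto
      then show "const (a X) * p X \<in> polys ?N" by (simp add: polys_mult)
      show "a X \<odot>\<^bsub>?Q\<^esub> X = cls J (const (a X) * p X)"
        using Q.smult_Q[OF X(1), of "a X"] by (simp flip: X(2))
    qed (use B in auto)
    then have "var i ^ K - (\<Sum>X\<in>B. const (a X) * p X) \<in> J"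
      using B(3) by (simp add: Q.cls_eq_iff)
    then obtain r where r: "\<forall>j. r j \<in> polys ?N"
      and eq: "var i ^ K - (\<Sum>X\<in>B. const (a X) * p X) = (\<Sum>j<?N. r j * partial j \<Omega>)"
      using genideal_subset[of ?N "\<lambda>j. partial j \<Omega>"] polys_partial[OF \<Omega>]
      unfolding J_def gens by blast
    have "hcomp K (const (a X) * p X) = 0" if "X \<in> B" for X
    proof -
      have "Poly_Mapping.lookup (p X) m = 0" if "mdeg m = K" for m
      proof (rule ccontr)
        assume "Poly_Mapping.lookup (p X) m \<noteq> 0"
        then have "mdeg m < b X" using b[of X] by (simp add: in_keys_iff)
        then show False using K(2)[of X] B(2) \<open>X \<in> B\<close> \<open>mdeg m = K\<close> by auto
      qed
      then have "Poly_Mapping.lookup (hcomp K (const (a X) * p X)) m = 0" for m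
        using lookup_single_mult[of 0 "a X" "p X" m] by (simp add: hcomp_def lookup_filt const_def)
      then show ?thesis by (intro poly_mapping_eqI) simp
    qed
    then have "hcomp K (var i ^ K - (\<Sum>X\<in>B. const (a X) * p X)) = var i ^ K"
      using hcomp_homogeneous[OF homogeneous_power[OF homogeneous_var], of K i K]
      by (simp add: hcomp_diff hcomp_sum)
    moreover have "hcomp K (r j * partial j \<Omega>) = hcomp (K - (n + d)) (r j) * partial j \<Omega>" for j
      using hcomp_mult_homogeneous[of "n + d" "partial j \<Omega>" "K - (n + d)" "r j"] K(1)
        homogeneous_partial[of "n + d" \<Omega> j] hom by (simp add: One_nat_def)
    ultimately have "var i ^ K = (\<Sum>j<?N. hcomp (K - (n + d)) (r j) * partial j \<Omega>)"
      unfolding eq hcomp_sum by simp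
    then show ?thesis
      using r by (intro exI[of _ "\<lambda>j. hcomp (K - (n + d)) (r j)"])
        (auto intro: polys_hcomp homogeneous_hcomp)
  qed
  then have "\<forall>i\<in>{..<?N}. \<exists>c. (\<forall>j. c j \<in> polys ?N \<and> homogeneous (K - (n + d)) (c j)) \<and>
      var i ^ K = (\<Sum>j<?N. c j * partial j \<Omega>)"
    by blast
  from bchoice[OF this] obtain c where
    c: "\<And>i. i < ?N \<Longrightarrow> (\<forall>j. c i j \<in> polys ?N \<and> homogeneous (K - (n + d)) (c i j)) \<and>
      var i ^ K = (\<Sum>j<?N. c i j * partial j \<Omega>)"
    by blast
  show ?thesis
  \<comment> \<open>The coefficients are required to be forms for every index; 0 is a form of every
    degree.\<close>
  proof (rule that[of K "\<lambda>i j. if i < ?N then c i j else 0"])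
    show "homogeneous (K - (n + d)) (if i < ?N then c i j else 0)" for i j
      using c by (simp add: homogeneous_iff)
  qed (use c K(1) in \<open>auto simp del: sum.lessThan_Suc\<close>)
qed

section \<open>The Nambu-Poisson algebra of a potential\<close>

lemma std_zero [simp]: "0 \<in> std N i"
  by (simp add: std_def)

lemma std_add: "p \<in> std N i \<Longrightarrow> q \<in> std N i \<Longrightarrow> p + q \<in> std N i"
  using keys_add[of p q] by (auto simp: std_def polys_add)

lemma std_mult: "p \<in> std N i \<Longrightarrow> q \<in> std N j \<Longrightarrow> p * q \<in> std N (i + j)"
  using keys_mult[of p q] by (fastforce simp: std_def polys_mult mdeg_add)

lemma std_0_eq: "std N 0 = (range const :: 'a::comm_ring_1 mpoly set)"
proof
  show "std N 0 \<subseteq> (range const :: 'a mpoly set)"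
  proof
    fix p :: "'a mpoly" assume p: "p \<in> std N 0"
    have "p = const (Poly_Mapping.lookup p 0)"
      using p by (intro poly_mapping_eqI)
        (auto simp: std_def mdeg_0_iff const_def lookup_single when_def in_keys_iff)
    then show "p \<in> range const" by blast
  qed
  show "(range const :: 'a mpoly set) \<subseteq> std N 0"
    using homogeneous_const by (auto simp: std_def homogeneous_iff)
qed

lemma std_pos: "i > 0 \<Longrightarrow> std N i = {0}"
  by (force simp: std_def)

lemma std_sum: "(\<And>x. x \<in> A \<Longrightarrow> f x \<in> std N i) \<Longrightarrow> sum f A \<in> std N i"
  by (induction A rule: infinite_finite_induct) (auto intro: std_add)

lemma std_prod:
  fixes f :: "'b \<Rightarrow> 'a::comm_ring_1 mpoly"
  shows "finite A \<Longrightarrow> (\<And>x. x \<in> A \<Longrightarrow> f x \<in> std N (e x)) \<Longrightarrow> prod f A \<in> std N (sum e A)"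
proof (induction A rule: finite_induct)
  case empty
  have "(1 :: 'a mpoly) \<in> std N 0" unfolding std_0_eq by (metis const_1 rangeI)
  then show ?case by simp
qed (auto intro: std_mult)

lemma std_partial:
  assumes "p \<in> std N i"
  shows "partial j p \<in> std N (i + 1)"
proof -
  have "int (mdeg m) = - (i + 1)" if "m \<in> Poly_Mapping.keys (partial j p)" for m
  proof -
    have "m + Poly_Mapping.single j 1 \<in> Poly_Mapping.keys p"
      using that by (auto simp: in_keys_iff lookup_partial)
    then have "int (mdeg (m + Poly_Mapping.single j 1)) = - i"
      using assms by (simp add: std_def)
    then show ?thesis by (simp add: mdeg_add)
  qed
  then show ?thesis using assms by (simp add: std_def polys_partial)
qed

lemma hcomp_std:
  assumes "p \<in> std N j" "i \<le> 0"
  shows "hcomp (nat (- i)) p = (if j = i then p else 0)"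
proof (cases "j \<le> 0")
  case True
  then have "homogeneous (nat (- j)) p" using assms(1) by (auto simp: homogeneous_iff std_def)
  then show ?thesis using True assms(2) by (auto simp: hcomp_homogeneous)
next
  case False
  then have "p = 0" using assms(1) by (simp add: std_pos)
  then show ?thesis by simp
qed

text \<open>Differentiation raises the grade by 1 in each row. The n rows of arguments contribute
  \<open>sum_list is + n\<close> and the row of \<Omega> contributes - (n + d), which leaves the
  shift by d.\<close>

lemma br_std:
  assumes "length us = n" "length is = n" "\<And>s. s < n \<Longrightarrow> us ! s \<in> std (n + 1) (is ! s)"
    and "\<Omega> \<in> std (n + 1) (- int (n + 1 + d))"
  shows "br n \<Omega> us \<in> std (n + 1) (sum_list is - int d)"
proof -
  define e where "e i = (if i < n then is ! i + 1 else - int (n + d))" for i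
  have sgn: "signof p * x \<in> std (n + 1) i" if "x \<in> std (n + 1) i" for p i and x :: "'a mpoly"
    using that by (simp add: sign_def std_def)
  have entry: "partial j ((us @ [\<Omega>]) ! i) \<in> std (n + 1) (e i)" if "i < n + 1" for i j
  proof (cases "i < n")
    case True
    then show ?thesis using assms(1) std_partial[OF assms(3)] by (simp add: e_def nth_append)
  next
    case False
    then show ?thesis
      using that assms(1) std_partial[OF assms(4), of j] by (simp add: e_def nth_append less_Suc_eq)
  qed
  have "br n \<Omega> us \<in> std (n + 1) (\<Sum>i = 0..<n + 1. e i)"
    unfolding br_def dt_leibniz by (intro std_sum sgn std_prod entry) auto
  moreover have "(\<Sum>i = 0..<n + 1. e i) = (\<Sum>i<n. e i) + e n"
    by (simp add: atLeast0LessThan flip: Suc_eq_plus1)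
  moreover have "(\<Sum>i<n. e i) = sum_list is + int n"
    using assms(2) by (simp add: e_def sum.distrib sum_list_sum_nth atLeast0LessThan)
  moreover have "e n = - int (n + d)" by (simp add: e_def)
  ultimately show ?thesis by simp
qed

text \<open>Replacing an argument y by y + \<Omega> r changes the bracket by a multiple of \<Omega>
  plus r times a bracket with \<Omega> as an argument, and the latter bracket vanishes.\<close>

lemma dvd_br_diff:
  assumes "length us = n" "length xs = n" "\<And>s. s < n \<Longrightarrow> \<Omega> dvd xs ! s - us ! s"
  shows "\<Omega> dvd br n \<Omega> xs - br n \<Omega> us"
proof -
  have upd: "\<Omega> dvd br n \<Omega> (us[s := x]) - br n \<Omega> (us[s := y])"
    if "length us = n" "s < n" "\<Omega> dvd x - y" for us s x y
  proof -
    obtain r where r: "x - y = \<Omega> * r" using \<open>\<Omega> dvd x - y\<close> by (elim dvdE)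
    then have "x = y + \<Omega> * r" by (simp add: algebra_simps)
    then have "br n \<Omega> (us[s := x]) - br n \<Omega> (us[s := y]) =
        \<Omega> * br n \<Omega> (us[s := r]) + br n \<Omega> (us[s := \<Omega>]) * r"
      using that by (simp add: br_add br_mult)
    also have "br n \<Omega> (us[s := \<Omega>]) = 0"
      using that by (intro br_potential[of _ _ s]) auto
    finally show ?thesis by simp
  qed
  \<comment> \<open>The arguments are exchanged one at a time, from the left.\<close>
  have "\<Omega> dvd br n \<Omega> (take k xs @ drop k us) - br n \<Omega> us" if "k \<le> n" for k
    using that
  proof (induction k)
    case (Suc k)
    let ?w = "take k xs @ drop k us"
    have len: "length ?w = n" using Suc.prems assms(1,2) by simp
    have "take (Suc k) xs @ drop (Suc k) us = ?w[k := xs ! k]"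
      using Suc.prems assms(1,2)
      by (intro nth_equalityI) (auto simp: nth_append nth_list_update less_Suc_eq)
    moreover have "?w = ?w[k := us ! k]"
      using Suc.prems assms(1,2)
      by (intro nth_equalityI) (auto simp: nth_append nth_list_update)
    ultimately have "\<Omega> dvd br n \<Omega> (take (Suc k) xs @ drop (Suc k) us) - br n \<Omega> ?w"
      using upd[OF len, of k "xs ! k" "us ! k"] assms(3)[of k] Suc.prems by simp
    from dvd_add[OF this Suc.IH] show ?case using Suc.prems by simp
  qed simp
  from this[of n] show ?thesis using assms(1,2) by simp
qed

lemma in_listset_iff:
  "xs \<in> listset As \<longleftrightarrow> length xs = length As \<and> (\<forall>s<length As. xs ! s \<in> As ! s)"
proof (induction As arbitrary: xs)
  case (Cons A As)
  show ?case
  proof (cases xs)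
    case (Cons a ys)
    then show ?thesis
      using Cons.IH by (auto simp: set_Cons_def nth_Cons' less_Suc_eq_0_disj)
  qed (auto simp: set_Cons_def)
qed simp

lemma set_update_subsetI: "set us \<subseteq> A \<Longrightarrow> z \<in> A \<Longrightarrow> set (us[s := z]) \<subseteq> A"
  using set_update_subset_insert[of us s z] by blast

lemma map_obtain:
  assumes "set Us \<subseteq> f ` A"
  obtains us where "Us = map f us" "set us \<subseteq> A"
proof -
  have "\<exists>us. Us = map f us \<and> set us \<subseteq> A"
    using assms
  proof (induction Us)
    case (Cons U Us)
    then obtain us u where "Us = map f us" "set us \<subseteq> A" "u \<in> A" "U = f u" by auto
    then show ?case by (intro exI[of _ "u # us"]) auto
  qed simp
  then show ?thesis using that by blast
qed

section \<open>The bracket on the quotient\<close>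

locale potential_quotient =
  fixes n d\<^sub>0 K :: nat and \<Omega> :: "'a::field_char_0 mpoly" and c :: "nat \<Rightarrow> nat \<Rightarrow> 'a mpoly"
  assumes n_pos: "1 \<le> n" and d\<^sub>0_pos: "1 \<le> d\<^sub>0"
    and \<Omega>_hom: "homogeneous (n + 1 + d\<^sub>0) \<Omega>" and \<Omega>_polys: "\<Omega> \<in> polys (n + 1)"
    and K_ge: "n + d\<^sub>0 \<le> K"
    and jac: "\<And>i. i < n + 1 \<Longrightarrow> var i ^ K = (\<Sum>j<n + 1. c i j * partial j \<Omega>)"
    and c_polys: "\<And>i j. c i j \<in> polys (n + 1)"
    and c_hom: "\<And>i j. homogeneous (K - (n + d\<^sub>0)) (c i j)"
begin

definition I where "I = {f \<in> polys (n + 1). \<Omega> dvd f}"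

abbreviation P where "P \<equiv> P_Omega n \<Omega>"

lemma P_eq: "P = quot_nambu (A_Omega n \<Omega>) I"
  using poly_record.genideal_singleton[OF poly_record_A_Omega \<Omega>_polys, of \<Omega>]
  by (simp add: P_Omega_def I_def)

lemma poly_ideal_I: "poly_ideal (n + 1) I"
  by unfold_locales (auto simp: I_def polys_add polys_mult)

sublocale quotient_poly_alg "n + 1" I P
proof -
  interpret poly_record "n + 1" "A_Omega n \<Omega>" by (rule poly_record_A_Omega)
  show "quotient_poly_alg (n + 1) I P"
    using quotient_quot_alg[OF poly_ideal_I]
    unfolding quotient_poly_alg_def quotient_poly_alg_axioms_def P_eq
    by (simp add: quot_nambu_def module.extend_def)
qed

text \<open>By \<open>dvd_br_diff\<close> all members of the union in \<open>quot_nambu\<close> are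
  the same coset.\<close>

lemma nbracket_P:
  assumes "length us = n" "set us \<subseteq> polys (n + 1)"
  shows "nbracket P (map (cls I) us) = cls I (br n \<Omega> us)"
proof -
  interpret poly_record "n + 1" "A_Omega n \<Omega>" by (rule poly_record_A_Omega)
  have "nbracket (A_Omega n \<Omega>) xs = br n \<Omega> xs" for xs
    by (simp add: A_Omega_def module.extend_def nambu_alg.fields_def br_def dt_def)
  then have "nbracket P Xs = (\<Union>xs\<in>listset Xs. cls I (br n \<Omega> xs))" for Xs
    by (simp add: P_eq quot_nambu_def module.extend_def nambu_alg.fields_def r_coset_eq_cls)
  moreover have "cls I (br n \<Omega> xs) = cls I (br n \<Omega> us)" if "xs \<in> listset (map (cls I) us)" for xs
  proof -
    have xs: "length xs = n" "\<And>s. s < n \<Longrightarrow> xs ! s \<in> cls I (us ! s)"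
      using that assms(1) by (auto simp: in_listset_iff)
    have "us ! s \<in> polys (n + 1)" if "s < n" for s using that assms by auto
    then have "set xs \<subseteq> polys (n + 1)"
      using xs cls_polys by (fastforce simp: set_conv_nth)
    then have "br n \<Omega> xs - br n \<Omega> us \<in> polys (n + 1)"
      using assms xs(1) \<Omega>_polys by (intro polys_diff br_polys)
    moreover have "\<Omega> dvd br n \<Omega> xs - br n \<Omega> us"
    proof (rule dvd_br_diff)
      fix s assume "s < n"
      then have "xs ! s - us ! s \<in> I" using xs(2) by (simp add: mem_cls)
      then show "\<Omega> dvd xs ! s - us ! s" by (simp add: I_def)
    qed (use assms(1) xs(1) in auto)
    ultimately have "br n \<Omega> xs - br n \<Omega> us \<in> I" by (simp add: I_def)
    then show ?thesis by (simp only: cls_eq_iff)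
  qed
  moreover have "us \<in> listset (map (cls I) us)"
    using cls_self by (simp add: in_listset_iff)
  ultimately show ?thesis by blast
qed

lemma obtain_list:
  assumes "set Us \<subseteq> carrier P"
  obtains us where "Us = map (cls I) us" "set us \<subseteq> polys (n + 1)"
  using assms unfolding carrier_Q by (rule map_obtain)

lemma obtain_cls:
  assumes "X \<in> carrier P"
  obtains x where "X = cls I x" "x \<in> polys (n + 1)"
  using assms by (auto simp: carrier_Q)

lemma nambu_poisson_algebra_P: "nambu_poisson_algebra n class_ring P"
proof (rule nambu_poisson_algebra.intro[OF algebra_Q nambu_poisson_algebra_axioms.intro], goal_cases)
  case (1 Us)
  then obtain us where us: "Us = map (cls I) us" "set us \<subseteq> polys (n + 1)"
    by (elim obtain_list)
  with 1 show ?case using \<Omega>_polys by (auto simp: nbracket_P carrier_Q intro: br_polys)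
next
  case (2 Us s X Y)
  then obtain us x y where us: "Us = map (cls I) us" "set us \<subseteq> polys (n + 1)"
    "X = cls I x" "x \<in> polys (n + 1)" "Y = cls I y" "y \<in> polys (n + 1)"
    by (elim obtain_list obtain_cls)
  note upd = set_update_subsetI[OF us(2)]
  show ?case
    using 2 us \<Omega>_polys
    by (simp add: add_Q polys_add nbracket_P upd br_polys br_add flip: map_update)
next
  case (3 Us s a X)
  then obtain us x where us: "Us = map (cls I) us" "set us \<subseteq> polys (n + 1)"
    "X = cls I x" "x \<in> polys (n + 1)"
    by (elim obtain_list obtain_cls)
  note upd = set_update_subsetI[OF us(2)]
  show ?case
    using 3 us \<Omega>_polys
    by (simp add: smult_Q polys_mult nbracket_P upd br_polys br_const_mult flip: map_update)
next
  case (4 Us r s)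
  then obtain us where us: "Us = map (cls I) us" "set us \<subseteq> polys (n + 1)"
    by (elim obtain_list)
  \<comment> \<open>Equal cosets may have been given different representatives; using the one at
    \<open>r\<close> also at \<open>s\<close> makes the bracket of polynomials itself
    vanish.\<close>
  have upd: "set (us[s := us ! r]) \<subseteq> polys (n + 1)"
    using us 4 by (intro set_update_subsetI) auto
  have "Us = map (cls I) (us[s := us ! r])"
    using 4 us(1) by (metis length_map list_update_id map_update nth_map)
  moreover have "br n \<Omega> (us[s := us ! r]) = 0"
    using 4 us(1) by (intro br_alternating[of _ n r s]) auto
  ultimately show ?case
    using nbracket_P[OF _ upd] 4 us(1) by (simp add: zero_Q)
next
  case (5 Us Vs)
  then obtain us vs where us: "Us = map (cls I) us" "set us \<subseteq> polys (n + 1)"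
    "Vs = map (cls I) vs" "set vs \<subseteq> polys (n + 1)"
    by (elim obtain_list)
  have len: "length us = n" "length vs = n - 1" using 5 us by auto
  have b: "br n \<Omega> (u # vs) \<in> polys (n + 1)" if "u \<in> polys (n + 1)" for u
    using that us len n_pos \<Omega>_polys by (intro br_polys) auto
  have nb: "nbracket P (cls I u # Vs) = cls I (br n \<Omega> (u # vs))" if "u \<in> polys (n + 1)" for u
    using nbracket_P[of "u # vs"] that us len n_pos by simp
  have mem: "us ! s \<in> polys (n + 1)" if "s < n" for s
    using that us(2) len nth_mem[of s us] by auto
  note upd = set_update_subsetI[OF us(2)]
  have "(\<Oplus>\<^bsub>P\<^esub>s\<in>{..<n}. nbracket P (Us[s := nbracket P (Us ! s # Vs)])) =
      cls I (\<Sum>s<n. br n \<Omega> (us[s := br n \<Omega> (us ! s # vs)]))"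
  proof (rule finsum_Q)
    fix s assume s: "s \<in> {..<n}"
    then show "br n \<Omega> (us[s := br n \<Omega> (us ! s # vs)]) \<in> polys (n + 1)"
      using len \<Omega>_polys by (intro br_polys upd b mem) auto
    show "nbracket P (Us[s := nbracket P (Us ! s # Vs)]) =
        cls I (br n \<Omega> (us[s := br n \<Omega> (us ! s # vs)]))"
      using s us(1) len by (simp add: nb mem nbracket_P upd b flip: map_update)
  qed simp
  moreover have "nbracket P (nbracket P Us # Vs) = cls I (br n \<Omega> (br n \<Omega> us # vs))"
    using nb[OF br_polys[OF len(1) us(2) \<Omega>_polys]] nbracket_P[OF len(1) us(2)] us(1) by simp
  ultimately show ?case
    using br_fundamental_identity[OF len, of \<Omega>] n_pos by simp
next
  case (6 Us s X Y)
  then obtain us x y where us: "Us = map (cls I) us" "set us \<subseteq> polys (n + 1)"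
    "X = cls I x" "x \<in> polys (n + 1)" "Y = cls I y" "y \<in> polys (n + 1)"
    by (elim obtain_list obtain_cls)
  note upd = set_update_subsetI[OF us(2)]
  show ?case
    using 6 us \<Omega>_polys
    by (simp add: add_Q mult_Q polys_mult nbracket_P upd br_polys br_mult flip: map_update)
qed

end

section \<open>The standard grading and its uniqueness\<close>

context potential_quotient
begin

lemma \<Omega>_nonzero: "\<Omega> \<noteq> 0"
proof
  assume "\<Omega> = 0"
  then have "var 0 ^ K = (0 :: 'a mpoly)" using jac[of 0] by simp
  then show False by (metis lookup_single_eq lookup_zero var_power zero_neq_one)
qed

lemma \<Omega>_std: "\<Omega> \<in> std (n + 1) (- int (n + 1 + d\<^sub>0))"
  using \<Omega>_hom \<Omega>_polys by (simp add: std_def homogeneous_iff)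

definition std_grading :: "int \<Rightarrow> 'a mpoly set set" where
  "std_grading i = cls I ` std (n + 1) i"

lemma std_polys: "p \<in> std (n + 1) i \<Longrightarrow> p \<in> polys (n + 1)"
  by (simp add: std_def)

text \<open>The ideal is graded, so it contains the component of degree \<open>- i\<close> of the
  sum, which is \<open>p i\<close>.\<close>

lemma std_independent:
  assumes "finite S" "\<And>i. i \<in> S \<Longrightarrow> p i \<in> std (n + 1) i" "sum p S \<in> I" "i \<in> S"
  shows "p i \<in> I"
proof (cases "i \<le> 0")
  case True
  have "hcomp (nat (- i)) (sum p S) = (\<Sum>j\<in>S. if j = i then p i else 0)"
    unfolding hcomp_sum using hcomp_std[OF assms(2) True] by (intro sum.cong) auto
  also have "\<dots> = p i" using assms(1,4) by (simp add: sum.delta)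
  finally have "\<Omega> dvd p i"
    using assms(3) dvd_hcomp[OF \<Omega>_hom, of "sum p S" "nat (- i)"] by (simp add: I_def)
  then show ?thesis using std_polys[OF assms(2)[OF assms(4)]] by (simp add: I_def)
next
  case False
  then show ?thesis using assms(2)[OF assms(4)] I_zero by (simp add: std_pos)
qed

lemma std_decomposition:
  assumes "f \<in> polys (n + 1)"
  obtains p T where "finite T" "\<And>i. p i \<in> std (n + 1) i" "\<And>i. i \<notin> T \<Longrightarrow> p i = 0" "sum p T = f"
proof -
  obtain b where b: "\<forall>m\<in>Poly_Mapping.keys f. mdeg m < b" using mdeg_bound by blast
  define T where "T = (\<lambda>d. - int d) ` {..<b}"
  define p where "p i = (if i \<in> T then hcomp (nat (- i)) f else 0)" for i
  have "p i \<in> std (n + 1) i" for i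
    using homogeneous_hcomp[of "nat (- i)" f] polys_hcomp[OF assms, of "nat (- i)"]
    by (auto simp: p_def T_def std_def homogeneous_iff)
  moreover have "sum p T = (\<Sum>d<b. hcomp d f)"
    unfolding T_def by (subst sum.reindex) (auto simp: inj_on_def p_def T_def)
  moreover have "(\<Sum>d<b. hcomp d f) = f" using b by (intro sum_hcomp) auto
  ultimately show ?thesis
    using that[of T p] by (simp add: T_def p_def)
qed

lemma graded_algebra_std: "graded_algebra class_ring P std_grading"
proof (rule graded_algebra.intro[OF algebra_Q graded_algebra_axioms.intro], goal_cases)
  case (1 i)
  have "submodule class_ring (std_grading i) P"
  proof (rule submodule.intro)
    show "module class_ring P" using algebra_Q by (rule algebra.axioms(1))
    show "std_grading i \<subseteq> carrier P" by (auto simp: std_grading_def carrier_Q std_polys)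
    show "\<zero>\<^bsub>P\<^esub> \<in> std_grading i" by (simp add: std_grading_def zero_Q)
    fix X Y assume "X \<in> std_grading i" "Y \<in> std_grading i"
    then obtain x y where "X = cls I x" "x \<in> std (n + 1) i" "Y = cls I y" "y \<in> std (n + 1) i"
      by (auto simp: std_grading_def)
    then show "X \<oplus>\<^bsub>P\<^esub> Y \<in> std_grading i"
      by (simp add: std_grading_def add_Q std_polys std_add)
  next
    fix a :: 'a and X assume "X \<in> std_grading i"
    then obtain x where "X = cls I x" "x \<in> std (n + 1) i"
      by (auto simp: std_grading_def)
    moreover have "const a \<in> std (n + 1) 0" by (simp add: std_0_eq)
    ultimately show "a \<odot>\<^bsub>P\<^esub> X \<in> std_grading i"
      using std_mult[of "const a" "n + 1" 0 x i] by (simp add: std_grading_def smult_Q std_polys)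
  qed
  then show ?case using vectorspace_Q by (intro subspace.intro)
next
  case (2 X)
  then obtain x where x: "X = cls I x" "x \<in> polys (n + 1)" by (elim obtain_cls)
  obtain p T where p: "finite T" "\<And>i. p i \<in> std (n + 1) i" "\<And>i. i \<notin> T \<Longrightarrow> p i = 0" "sum p T = x"
    using std_decomposition[OF x(2)] by blast
  have sub: "{i. cls I (p i) \<noteq> \<zero>\<^bsub>P\<^esub>} \<subseteq> T" using p(3) by (auto simp: zero_Q)
  show ?case
  proof (rule ex1I[of _ "\<lambda>i. cls I (p i)"], intro conjI allI)
    show "cls I (p i) \<in> std_grading i" for i using p(2) by (simp add: std_grading_def)
    show "finite {i. cls I (p i) \<noteq> \<zero>\<^bsub>P\<^esub>}" using finite_subset[OF sub p(1)] .
    show "X = (\<Oplus>\<^bsub>P\<^esub>i\<in>{i. cls I (p i) \<noteq> \<zero>\<^bsub>P\<^esub>}. cls I (p i))"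
      using finsum_support[OF p(1) sub, of p] p(2,4) std_polys x(1) by blast
  next
    fix F assume F: "(\<forall>i. F i \<in> std_grading i) \<and> finite {i. F i \<noteq> \<zero>\<^bsub>P\<^esub>} \<and>
      X = (\<Oplus>\<^bsub>P\<^esub>i\<in>{i. F i \<noteq> \<zero>\<^bsub>P\<^esub>}. F i)"
    have "\<forall>i. \<exists>q. q \<in> std (n + 1) i \<and> F i = cls I q"
      using F unfolding std_grading_def by blast
    from choice[OF this] obtain q where q: "\<And>i. q i \<in> std (n + 1) i" "\<And>i. F i = cls I (q i)" by blast
    \<comment> \<open>Both decompositions are compared over one finite set that contains their
      supports; their difference is a relation between forms of different degrees.\<close>
    define U where "U = T \<union> {i. F i \<noteq> \<zero>\<^bsub>P\<^esub>}"
    have U: "finite U" "{i. F i \<noteq> \<zero>\<^bsub>P\<^esub>} \<subseteq> U" "T \<subseteq> U" using p(1) F by (auto simp: U_def)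
    have "X = cls I (sum q U)"
      using finsum_support[OF U(1,2) std_polys[OF q(1)] q(2)] F by metis
    moreover have "sum p U = sum p T"
      using U(1,3) p(3) by (intro sum.mono_neutral_right) auto
    ultimately have sumI: "sum (\<lambda>i. q i - p i) U \<in> I"
      using x(1) p(4) by (simp add: sum_subtractf flip: cls_eq_iff)
    have diff: "q i - p i \<in> I" if "i \<in> U" for i
    proof (rule std_independent[where p = "\<lambda>i. q i - p i", OF U(1) _ sumI that])
      fix j
      have "- p j \<in> std (n + 1) j" using p(2)[of j] by (simp add: std_def in_keys_iff)
      then show "q j - p j \<in> std (n + 1) j" using std_add[OF q(1)] by fastforce
    qed
    show "F = (\<lambda>i. cls I (p i))"
    proof
      fix i
      show "F i = cls I (p i)"
      proof (cases "i \<in> U")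
        case True
        then show ?thesis using diff q(2) by (simp add: cls_eq_iff)
      next
        case False
        then show ?thesis using U(3) p(3)[of i] by (auto simp: U_def zero_Q)
      qed
    qed
  qed
next
  case (3 X i Y j)
  then obtain x y where "X = cls I x" "x \<in> std (n + 1) i" "Y = cls I y" "y \<in> std (n + 1) j"
    by (auto simp: std_grading_def)
  then show ?case by (simp add: std_grading_def mult_Q std_polys std_mult)
qed

lemma connected_graded_algebra_std: "connected_graded_algebra class_ring P std_grading"
proof (rule connected_graded_algebra.intro[OF graded_algebra_std connected_graded_algebra_axioms.intro])
  show "std_grading i = {\<zero>\<^bsub>P\<^esub>}" if "i > 0" for i
    using that by (simp add: std_grading_def std_pos zero_Q)
  have "std_grading 0 = {cls I (const a) | a. a \<in> (UNIV :: 'a set)}"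
    by (auto simp: std_grading_def std_0_eq)
  then show "std_grading 0 = {a \<odot>\<^bsub>P\<^esub> \<one>\<^bsub>P\<^esub> | a. a \<in> carrier (class_ring :: 'a ring)}"
    by (simp add: one_Q smult_Q)
qed

lemma poisson_graded_algebra_std:
  "poisson_graded_algebra n (int d\<^sub>0) class_ring P std_grading"
proof (rule poisson_graded_algebra.intro[OF nambu_poisson_algebra_P graded_algebra_std
      poisson_graded_algebra_axioms.intro])
  fix "is" Us
  assume len: "length is = n" "length Us = n" and mem: "\<And>s. s < n \<Longrightarrow> Us ! s \<in> std_grading (is ! s)"
  have "\<forall>s\<in>{..<n}. \<exists>u. u \<in> std (n + 1) (is ! s) \<and> Us ! s = cls I u"
    using mem unfolding std_grading_def by blast
  from bchoice[OF this] obtain u where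
    u: "\<And>s. s < n \<Longrightarrow> u s \<in> std (n + 1) (is ! s)" "\<And>s. s < n \<Longrightarrow> Us ! s = cls I (u s)" by blast
  let ?us = "map u [0..<n]"
  have "Us = map (cls I) ?us" using len(2) u(2) by (intro nth_equalityI) auto
  moreover have "set ?us \<subseteq> polys (n + 1)" using std_polys[OF u(1)] by auto
  moreover have "br n \<Omega> ?us \<in> std (n + 1) (sum_list is - int d\<^sub>0)"
    using len(1) u(1) \<Omega>_std by (intro br_std) auto
  ultimately show "nbracket P Us \<in> std_grading (sum_list is - int d\<^sub>0)"
    using nbracket_P[of ?us] by (simp add: std_grading_def)
qed

section \<open>Uniqueness by passage to preimages\<close>

lemma grading_unique:
  assumes conn: "connected_graded_algebra class_ring P A"
    and pois: "poisson_graded_algebra n (int d\<^sub>0) class_ring P A"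
  shows "A = std_grading"
proof -
  interpret C: connected_graded_algebra class_ring P A by (rule conn)
  interpret B: poisson_graded_algebra n "int d\<^sub>0" class_ring P A by (rule pois)
  have sub: "submodule class_ring (A i) P" for i
    using C.component_subspace[of i] by (rule subspace.submod)
  have A_carrier: "A i \<subseteq> carrier P" for i
    using sub by (rule submodule.subset)
  define G where "G i = {f \<in> polys (n + 1). cls I f \<in> A i}" for i
  have A_zero: "cls I 0 \<in> A i" for i
    using submodule.zero_closed[OF sub] by (simp add: zero_Q)
  have const_A: "A 0 = {cls I (const a) | a. True}"
    using C.zero_component by (simp add: one_Q smult_Q)
  have G_const: "const a \<in> G 0" for a
    by (auto simp: G_def const_A)
  have G_ideal: "f \<in> G i" if "f \<in> I" for f i
  proof -
    have "cls I f = cls I 0" using that by (simp only: cls_eq_zero)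
    then show ?thesis using A_zero that I_polys by (auto simp: G_def)
  qed
  have "lifted_grading n d\<^sub>0 K \<Omega> c G"
  proof (unfold_locales, goal_cases)
    \<comment> \<open>The axioms from here on concern \<open>G\<close>; those on \<Omega> and the
      Jacobian data are inherited.\<close>
    case 10
    show ?case by (auto simp: G_def)
  next
    case (11 i f)
    then show ?case using G_ideal by (simp add: I_def)
  next
    case (12 i f g)
    then show ?case
      using submodule.m_closed[OF sub, of "cls I f" i "cls I g"] by (simp add: G_def add_Q polys_add)
  next
    case (13 i j f g)
    then show ?case
      using C.mult_component[of "cls I f" i "cls I g" j] by (simp add: G_def mult_Q polys_mult)
  next
    case (14 a)
    show ?case by (rule G_const)
  next
    case (15 f)
    then obtain F where F: "\<forall>i. F i \<in> A i" "finite {i. F i \<noteq> \<zero>\<^bsub>P\<^esub>}"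
      "cls I f = (\<Oplus>\<^bsub>P\<^esub>i\<in>{i. F i \<noteq> \<zero>\<^bsub>P\<^esub>}. F i)"
      using C.direct_sum[OF cls_carrier[OF 15]] by blast
    have "\<forall>i. \<exists>p. p \<in> polys (n + 1) \<and> F i = cls I p"
      using F(1) A_carrier unfolding carrier_Q by blast
    from choice[OF this] obtain p where p: "\<And>i. p i \<in> polys (n + 1)" "\<And>i. F i = cls I (p i)" by blast
    let ?S = "{i. F i \<noteq> \<zero>\<^bsub>P\<^esub>}"
    have "cls I f = cls I (sum p ?S)"
      using finsum_support[OF F(2) subset_refl p] F(3) by metis
    then have r: "f - sum p ?S \<in> G 0" by (intro G_ideal) (simp only: cls_eq_iff)
    have pG: "p i \<in> G i" for i using p F(1) by (metis (mono_tags, lifting) G_def mem_Collect_eq)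
    have "sum p S + (f - sum p ?S) \<in> gsum G UNIV" if "finite S" for S
      using that
    proof (induction S rule: finite_induct)
      case empty
      show ?case using gsum.add[of 0 UNIV "f - sum p ?S" G 0] r gsum.zero[of G UNIV] by simp
    next
      case (insert i S)
      then show ?case
        using gsum.add[of i UNIV "p i" G "sum p S + (f - sum p ?S)"] pG by (simp add: add.assoc)
    qed
    from this[OF F(2)] show ?case by simp
  next
    case (16 S h i)
    \<comment> \<open>\<open>direct_sum\<close> speaks of families indexed by all integers, so
      \<open>h\<close> is extended by 0.\<close>
    define g where "g j = (if j \<in> S then h j else 0)" for j
    have g: "g j \<in> G j" for j using 16(2) G_ideal[OF I_zero] by (simp add: g_def)
    have "sum g S = sum h S" by (simp add: g_def)
    moreover have "sum h S \<in> polys (n + 1)"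
      using 16(2) by (intro polys_sum) (simp add: G_def)
    ultimately have sumI: "sum g S \<in> I" using 16(3) by (simp add: I_def)
    have supp: "{i. cls I (g i) \<noteq> \<zero>\<^bsub>P\<^esub>} \<subseteq> S" by (auto simp: g_def zero_Q)
    have gp: "g j \<in> polys (n + 1)" for j using g[of j] by (simp add: G_def)
    have "(\<Oplus>\<^bsub>P\<^esub>i\<in>{i. cls I (g i) \<noteq> \<zero>\<^bsub>P\<^esub>}. cls I (g i)) = cls I (sum g S)"
      using finsum_support[OF 16(1) supp gp] by simp
    also have "\<dots> = \<zero>\<^bsub>P\<^esub>" using sumI by (simp add: zero_Q cls_eq_zero)
    finally have g_sum: "(\<Oplus>\<^bsub>P\<^esub>i\<in>{i. cls I (g i) \<noteq> \<zero>\<^bsub>P\<^esub>}. cls I (g i)) = \<zero>\<^bsub>P\<^esub>" .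
    \<comment> \<open>Both families decompose zero, and this decomposition is unique.\<close>
    have "(\<lambda>i. cls I (g i)) = (\<lambda>i. \<zero>\<^bsub>P\<^esub>)"
    proof (rule ex1E[OF C.direct_sum[of "\<zero>\<^bsub>P\<^esub>"]])
      show "\<zero>\<^bsub>P\<^esub> \<in> carrier P" by (simp add: zero_Q carrier_Q)
      fix F :: "int \<Rightarrow> 'a mpoly set"
      assume uniq: "\<forall>F'. (\<forall>i. F' i \<in> A i) \<and> finite {i. F' i \<noteq> \<zero>\<^bsub>P\<^esub>} \<and>
        \<zero>\<^bsub>P\<^esub> = (\<Oplus>\<^bsub>P\<^esub>i\<in>{i. F' i \<noteq> \<zero>\<^bsub>P\<^esub>}. F' i) \<longrightarrow> F' = F"
      have "(\<lambda>i. cls I (g i)) = F"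
        using g finite_subset[OF supp 16(1)] g_sum
        by (intro uniq[rule_format] conjI allI) (simp_all add: G_def)
      moreover have "(\<lambda>i. \<zero>\<^bsub>P\<^esub>) = F"
        using A_zero finsum_Q[of "{}" "\<lambda>_. 0"]
        by (intro uniq[rule_format] conjI allI) (simp_all add: zero_Q)
      ultimately show "(\<lambda>i. cls I (g i)) = (\<lambda>i. \<zero>\<^bsub>P\<^esub>)" by simp
    qed
    then have "cls I (g i) = cls I 0" by (metis zero_Q)
    then have "g i \<in> I" by (simp only: cls_eq_zero)
    then show ?case using 16(4) by (simp add: g_def I_def)
  next
    case (17 i f)
    then have "cls I f = cls I 0" using C.positive_component[of i] by (simp add: G_def zero_Q)
    then have "f \<in> I" by (simp only: cls_eq_zero)
    then show ?case by (simp add: I_def)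
  next
    case (18 f)
    then obtain a where "cls I f = cls I (const a)" by (auto simp: G_def const_A)
    then have "f - const a \<in> I" by (simp only: cls_eq_iff)
    then show ?case by (auto simp: I_def)
  next
    case (19 "is" us)
    have us: "set us \<subseteq> polys (n + 1)" using 19(2,3) by (auto simp: G_def set_conv_nth)
    have "nbracket P (map (cls I) us) \<in> A (sum_list is - int d\<^sub>0)"
      using 19 by (intro B.bracket_component) (auto simp: G_def)
    then show ?case
      using 19(2) us \<Omega>_polys by (simp add: G_def nbracket_P br_polys)
  qed (use n_pos d\<^sub>0_pos \<Omega>_nonzero \<Omega>_hom \<Omega>_polys K_ge jac c_polys c_hom in auto)
  then interpret L: lifted_grading n d\<^sub>0 K \<Omega> c G .
  show ?thesis
  proof
    fix i
    \<comment> \<open>The preimages determine the grading, and \<open>G_eq\<close> describes them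
      without reference to \<open>A\<close>.\<close>
    have "A i = cls I ` G i"
      using A_carrier[of i] by (auto simp: G_def carrier_Q)
    also have "\<dots> = cls I ` std (n + 1) i"
    proof (intro equalityI subsetI)
      fix X assume "X \<in> cls I ` G i"
      then obtain f p where f: "X = cls I f" "f \<in> polys (n + 1)" and p: "p \<in> std (n + 1) i" "\<Omega> dvd f - p"
        by (auto simp: L.G_eq)
      then have "f - p \<in> I" by (simp add: I_def polys_diff std_polys)
      then have "X = cls I p" by (simp only: f(1) cls_eq_iff)
      then show "X \<in> cls I ` std (n + 1) i" using p(1) by blast
    next
      fix X assume "X \<in> cls I ` std (n + 1) i"
      then show "X \<in> cls I ` G i" using L.std_component by blast
    qed
    finally show "A i = std_grading i" by (simp add: std_grading_def)
  qed
qed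

lemma unique_grading:
  "\<exists>!A. connected_graded_algebra class_ring P A \<and>
    poisson_graded_algebra n (int d\<^sub>0) class_ring P A"
proof (rule ex1I)
  show "connected_graded_algebra class_ring P std_grading \<and>
      poisson_graded_algebra n (int d\<^sub>0) class_ring P std_grading"
    by (rule conjI[OF connected_graded_algebra_std poisson_graded_algebra_std])
qed (blast intro: grading_unique)

end

theorem theorem0p9:
  fixes \<Omega> :: "'a::field_char_0 mpoly" and n d\<^sub>0 :: nat
  assumes "n \<ge> 3" and "d\<^sub>0 \<ge> 2"
    and "is_potential n \<Omega>" and "homogeneous (n + 1 + d\<^sub>0) \<Omega>"
  shows "\<exists>!A :: int \<Rightarrow> 'a mpoly set set.
    connected_graded_algebra class_ring (P_Omega n \<Omega>) A \<and>
    poisson_graded_algebra n (int d\<^sub>0) class_ring (P_Omega n \<Omega>) A"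
proof -
  obtain K c where K: "n + d\<^sub>0 \<le> K"
    "\<And>i. i < n + 1 \<Longrightarrow> var i ^ K = (\<Sum>j<n + 1. c i j * partial j \<Omega>)"
    "\<And>i j. c i j \<in> polys (n + 1)" "\<And>i j. homogeneous (K - (n + d\<^sub>0)) (c i j)"
    using potential_variable_powers[OF assms(3,4)] by blast
  have "\<Omega> \<in> polys (n + 1)"
    using assms(3) by (simp add: is_potential_def polys_def)
  then have "potential_quotient n d\<^sub>0 K \<Omega> c"
    using assms(1,2) by (intro potential_quotient.intro K assms(4)) simp_all
  then show ?thesis by (rule potential_quotient.unique_grading)
qed

end
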